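(* There is a polynomial-time algorithm which, given a hypergraph $H$ of rank 2 (i.e. all of whose edges have at most 2 vertices), computes the outcome $o(H)\in\{\mathcal{A},\mathcal{SL},\mathcal{E}\}$ of the Avoider-Enforcer game on $H$.
   Context: A hypergraph $H$ has a finite vertex set $V(H)$ and an edge set $E(H)\subseteq 2^{V(H)}$ (the empty edge is allowed). In the Avoider-Enforcer game on $H$, two players, Avoider and Enforcer, alternately pick one previously unpicked vertex of $H$ until all vertices have been picked. Enforcer wins if at the end Avoider has picked all the vertices of some edge of $H$; otherwise Avoider wins (in particular Enforcer wins if $\varnothing\in E(H)$). The last player is the player who makes the last move of the game: this is the first player if $|V(H)|$ is odd and the second player if $|V(H)|$ is even; the other player is the second-to-last player. A player "wins on $H$ as last (resp. second-to-last) player" if that player has a winning strategy when they are the last (resp. second-to-last) player. The outcome $o(H)$ is: $\mathcal{A}$ if Avoider wins on $H$ both as last player and as second-to-last player; $\mathcal{E}$ if Enforcer wins on $H$ both as last player and as second-to-last player; $\mathcal{SL}$ if whichever player is second-to-last wins. These are the only three possibilities. *)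

theory Defs
  imports Main
begin

section \<open>Hypergraphs\<close>

record 'a hypergraph =
  verts :: "'a set"
  edges :: "'a set set"

definition hypergraph :: "'a hypergraph \<Rightarrow> bool" where
  "hypergraph H \<longleftrightarrow> finite (verts H) \<and> edges H \<subseteq> Pow (verts H)"

text \<open>Edges of size 0 and 1 are allowed.\<close>

definition rank_le :: "nat \<Rightarrow> 'a hypergraph \<Rightarrow> bool" where
  "rank_le k H \<longleftrightarrow> (\<forall>e\<in>edges H. card e \<le> k)"

definition hypergraph_size :: "'a hypergraph \<Rightarrow> nat" where
  "hypergraph_size H = card (verts H) + card (edges H) + (\<Sum>e\<in>edges H. card e)"


section \<open>The Avoider-Enforcer game\<close>

datatype player = Avoider | Enforcer

fun opponent :: "player \<Rightarrow> player" where
  "opponent Avoider = Enforcer"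
| "opponent Enforcer = Avoider"

text \<open>Moves are numbered from 0; \<open>f\<close> is the first player.\<close>

definition turn :: "player \<Rightarrow> nat \<Rightarrow> player" where
  "turn f i = (if even i then f else opponent f)"

text \<open>A complete play is the list of all vertices in the order in which they are picked.\<close>

definition plays :: "'a hypergraph \<Rightarrow> 'a list set" where
  "plays H = {vs. distinct vs \<and> set vs = verts H}"

definition picks :: "player \<Rightarrow> player \<Rightarrow> 'a list \<Rightarrow> 'a set" where
  "picks f p vs = {vs ! i | i. i < length vs \<and> turn f i = p}"

fun wins_play :: "'a hypergraph \<Rightarrow> player \<Rightarrow> player \<Rightarrow> 'a list \<Rightarrow> bool" where
  "wins_play H f Enforcer vs \<longleftrightarrow> (\<exists>e\<in>edges H. e \<subseteq> picks f Avoider vs)"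
| "wins_play H f Avoider vs \<longleftrightarrow> \<not> (\<exists>e\<in>edges H. e \<subseteq> picks f Avoider vs)"

text \<open>A strategy maps the sequence of moves made so far to the next vertex to pick.\<close>

definition legal_strategy :: "'a hypergraph \<Rightarrow> ('a list \<Rightarrow> 'a) \<Rightarrow> bool" where
  "legal_strategy H \<sigma> \<longleftrightarrow>
     (\<forall>h. distinct h \<and> set h \<subset> verts H \<longrightarrow> \<sigma> h \<in> verts H - set h)"

definition follows :: "player \<Rightarrow> player \<Rightarrow> ('a list \<Rightarrow> 'a) \<Rightarrow> 'a list \<Rightarrow> bool" where
  "follows f p \<sigma> vs \<longleftrightarrow> (\<forall>i<length vs. turn f i = p \<longrightarrow> vs ! i = \<sigma> (take i vs))"

definition has_winning_strategy :: "'a hypergraph \<Rightarrow> player \<Rightarrow> player \<Rightarrow> bool" where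
  "has_winning_strategy H f p \<longleftrightarrow>
     (\<exists>\<sigma>. legal_strategy H \<sigma> \<and> (\<forall>vs\<in>plays H. follows f p \<sigma> vs \<longrightarrow> wins_play H f p vs))"

definition wins_as_last :: "'a hypergraph \<Rightarrow> player \<Rightarrow> bool" where
  "wins_as_last H p \<longleftrightarrow>
     has_winning_strategy H (if odd (card (verts H)) then p else opponent p) p"

definition wins_as_second_to_last :: "'a hypergraph \<Rightarrow> player \<Rightarrow> bool" where
  "wins_as_second_to_last H p \<longleftrightarrow>
     has_winning_strategy H (if odd (card (verts H)) then opponent p else p) p"

datatype outcome = Outcome_A | Outcome_SL | Outcome_E

fun has_outcome :: "'a hypergraph \<Rightarrow> outcome \<Rightarrow> bool" where
  "has_outcome H Outcome_A \<longleftrightarrow>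
     wins_as_last H Avoider \<and> wins_as_second_to_last H Avoider"
| "has_outcome H Outcome_E \<longleftrightarrow>
     wins_as_last H Enforcer \<and> wins_as_second_to_last H Enforcer"
| "has_outcome H Outcome_SL \<longleftrightarrow>
     wins_as_second_to_last H Avoider \<and> wins_as_second_to_last H Enforcer"

text \<open>Two strategies determine a play, so the two players cannot both win, and a hypergraph
  has at most one outcome.\<close>

fun joint_play :: "player \<Rightarrow> player \<Rightarrow> ('a list \<Rightarrow> 'a) \<Rightarrow> ('a list \<Rightarrow> 'a) \<Rightarrow> nat \<Rightarrow> 'a list" where
  "joint_play f p \<sigma> \<tau> 0 = []"
| "joint_play f p \<sigma> \<tau> (Suc n) =
     (let h = joint_play f p \<sigma> \<tau> n in h @ [if turn f n = p then \<sigma> h else \<tau> h])"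

lemma opponent_neq [simp]: "opponent p \<noteq> p" "p \<noteq> opponent p"
  by (cases p; simp)+

lemma length_joint_play [simp]: "length (joint_play f p \<sigma> \<tau> n) = n"
  by (induction n) (auto simp: Let_def)

lemma take_joint_play: "i \<le> n \<Longrightarrow> take i (joint_play f p \<sigma> \<tau> n) = joint_play f p \<sigma> \<tau> i"
proof (induction n)
  case (Suc n)
  then show ?case by (cases "i = Suc n") (auto simp: Let_def)
qed simp

lemma nth_joint_play:
  assumes "i < n"
  shows "joint_play f p \<sigma> \<tau> n ! i =
    (if turn f i = p then \<sigma> (joint_play f p \<sigma> \<tau> i) else \<tau> (joint_play f p \<sigma> \<tau> i))"
proof -
  have "joint_play f p \<sigma> \<tau> n ! i = take (Suc i) (joint_play f p \<sigma> \<tau> n) ! i"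
    by simp
  also have "\<dots> = joint_play f p \<sigma> \<tau> (Suc i) ! i"
    using assms by (simp only: take_joint_play Suc_leI)
  finally show ?thesis by (simp add: Let_def nth_append)
qed

lemma joint_play_legal:
  assumes "finite (verts H)" "legal_strategy H \<sigma>" "legal_strategy H \<tau>" "n \<le> card (verts H)"
  shows "distinct (joint_play f p \<sigma> \<tau> n) \<and> set (joint_play f p \<sigma> \<tau> n) \<subseteq> verts H"
  using assms(4)
proof (induction n)
  case (Suc n)
  define h where "h = joint_play f p \<sigma> \<tau> n"
  have h: "distinct h" "set h \<subseteq> verts H" using Suc by (auto simp: h_def)
  have "card (set h) < card (verts H)"
    using Suc.prems h(1) by (simp add: h_def distinct_card)
  hence "set h \<subset> verts H" using h(2) by auto
  hence "\<sigma> h \<in> verts H - set h" "\<tau> h \<in> verts H - set h"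
    using assms h unfolding legal_strategy_def by blast+
  thus ?case using h by (auto simp: Let_def h_def[symmetric])
qed simp

lemma not_both_win:
  assumes H: "finite (verts H)"
  shows "\<not> (has_winning_strategy H f Avoider \<and> has_winning_strategy H f Enforcer)"
proof
  assume "has_winning_strategy H f Avoider \<and> has_winning_strategy H f Enforcer"
  then obtain \<sigma> \<tau> where s: "legal_strategy H \<sigma>" "legal_strategy H \<tau>"
    and w: "\<And>vs. vs \<in> plays H \<Longrightarrow> follows f Avoider \<sigma> vs \<Longrightarrow> wins_play H f Avoider vs"
      "\<And>vs. vs \<in> plays H \<Longrightarrow> follows f Enforcer \<tau> vs \<Longrightarrow> wins_play H f Enforcer vs"
    unfolding has_winning_strategy_def by blast
  define vs where "vs = joint_play f Avoider \<sigma> \<tau> (card (verts H))"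
  have l: "distinct vs" "set vs \<subseteq> verts H"
    using joint_play_legal[OF H s, of "card (verts H)" f Avoider] by (auto simp: vs_def)
  have "card (set vs) = card (verts H)"
    using l by (simp add: distinct_card vs_def)
  hence "vs \<in> plays H" using l H by (auto simp: plays_def dest: card_subset_eq)
  moreover have "follows f Avoider \<sigma> vs" "follows f Enforcer \<tau> vs"
    by (auto simp: follows_def vs_def nth_joint_play take_joint_play)
  ultimately show False using w[of vs] by auto
qed

lemma has_outcome_unique:
  assumes "hypergraph H" "has_outcome H r" "has_outcome H r'"
  shows "r = r'"
  using assms not_both_win[of H]
  by (cases r; cases r';
      auto simp: hypergraph_def wins_as_last_def wins_as_second_to_last_def split: if_splits)


section \<open>Machine model\<close>

text \<open>
  Programs for a random access machine with natural-number registers and an unbounded,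
  indirectly addressed memory.  Each instruction and each test costs one step.  Arithmetic is
  restricted to addition and truncated subtraction: without multiplication a number can at most
  double in one step, and therefore unit-cost running time is polynomially related to Turing
  machine time (Cook and Reckhow, Time bounded random access machines, 1973).  Structured
  control flow compiles to jumps with constant overhead.
\<close>

type_synonym reg = nat

datatype test = Less reg reg | Equal reg reg

datatype com =
    Skip
  | Const reg nat
  | Add reg reg reg
  | Sub reg reg reg
  | Load reg reg    \<comment> \<open>target register, register holding the address\<close>
  | Store reg reg   \<comment> \<open>register holding the address, source register\<close>
  | Seq com com
  | Cond test com com
  | While test com

record state =
  regs :: "reg \<Rightarrow> nat"
  mem :: "nat \<Rightarrow> nat"

fun holds :: "test \<Rightarrow> state \<Rightarrow> bool" where
  "holds (Less x y) s \<longleftrightarrow> regs s x < regs s y"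
| "holds (Equal x y) s \<longleftrightarrow> regs s x = regs s y"

text \<open>\<open>exec P s t s'\<close>: started in state \<open>s\<close>, program \<open>P\<close> halts in state \<open>s'\<close>
  after exactly \<open>t\<close> steps.\<close>

inductive exec :: "com \<Rightarrow> state \<Rightarrow> nat \<Rightarrow> state \<Rightarrow> bool" where
  Skip: "exec Skip s 1 s"
| Const: "exec (Const x k) s 1 (s\<lparr>regs := (regs s)(x := k)\<rparr>)"
| Add: "exec (Add x y z) s 1 (s\<lparr>regs := (regs s)(x := regs s y + regs s z)\<rparr>)"
| Sub: "exec (Sub x y z) s 1 (s\<lparr>regs := (regs s)(x := regs s y - regs s z)\<rparr>)"
| Load: "exec (Load x y) s 1 (s\<lparr>regs := (regs s)(x := mem s (regs s y))\<rparr>)"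
| Store: "exec (Store x y) s 1 (s\<lparr>mem := (mem s)(regs s x := regs s y)\<rparr>)"
| Seq: "exec P s t s' \<Longrightarrow> exec Q s' u s'' \<Longrightarrow> exec (Seq P Q) s (t + u) s''"
| CondTrue: "holds b s \<Longrightarrow> exec P s t s' \<Longrightarrow> exec (Cond b P Q) s (1 + t) s'"
| CondFalse: "\<not> holds b s \<Longrightarrow> exec Q s t s' \<Longrightarrow> exec (Cond b P Q) s (1 + t) s'"
| WhileFalse: "\<not> holds b s \<Longrightarrow> exec (While b P) s 1 s"
| WhileTrue: "holds b s \<Longrightarrow> exec P s t s' \<Longrightarrow> exec (While b P) s' u s'' \<Longrightarrow>
    exec (While b P) s (1 + t + u) s''"

lemma exec_deterministic:
  "exec P s t s' \<Longrightarrow> exec P s u s'' \<Longrightarrow> u = t \<and> s'' = s'"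
proof (induction arbitrary: u s'' rule: exec.induct)
  case (Seq P s t s' Q v r)
  from Seq.prems obtain t1 s1 t2 where
    1: "exec P s t1 s1" and 2: "exec Q s1 t2 s''" and u: "u = t1 + t2"
    by (cases rule: exec.cases) simp_all
  have "t1 = t" "s1 = s'" using Seq.IH(1)[OF 1] by simp_all
  moreover have "t2 = v \<and> s'' = r" using Seq.IH(2) 2 \<open>s1 = s'\<close> by simp
  ultimately show ?case using u by simp
next
  case (CondTrue b s P t s' Q)
  from CondTrue.prems CondTrue.hyps(1) obtain t1 where
    1: "exec P s t1 s''" and u: "u = 1 + t1"
    by (cases rule: exec.cases) simp_all
  show ?case using CondTrue.IH[OF 1] u by simp
next
  case (CondFalse b s Q t s' P)
  from CondFalse.prems CondFalse.hyps(1) obtain t1 where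
    1: "exec Q s t1 s''" and u: "u = 1 + t1"
    by (cases rule: exec.cases) simp_all
  show ?case using CondFalse.IH[OF 1] u by simp
next
  case (WhileFalse b s P)
  from WhileFalse.prems WhileFalse.hyps show ?case
    by (cases rule: exec.cases) simp_all
next
  case (WhileTrue b s P t s' v r)
  from WhileTrue.prems WhileTrue.hyps(1) obtain t1 s1 t2 where
    1: "exec P s t1 s1" and 2: "exec (While b P) s1 t2 s''" and u: "u = 1 + t1 + t2"
    by (cases rule: exec.cases) simp_all
  have "t1 = t" "s1 = s'" using WhileTrue.IH(1)[OF 1] by simp_all
  moreover have "t2 = v \<and> s'' = r" using WhileTrue.IH(2) 2 \<open>s1 = s'\<close> by simp
  ultimately show ?case using u by simp
qed (erule exec.cases; simp)+


section \<open>Input and output of the algorithm\<close>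

text \<open>
  The vertices are numbered from 0 in an arbitrary way, and the edges are listed in an arbitrary
  order, each exactly once, as \<open>[e\<^sub>1, \<dots>, e\<^sub>m]\<close> with each \<open>e\<^sub>i\<close> a repetition-free list of vertex
  numbers.  The machine word sequence for \<open>H\<close> is
  \<open>n, m, |e\<^sub>1|, e\<^sub>1, \<dots>, |e\<^sub>m|, e\<^sub>m\<close> where \<open>n\<close> is the number of vertices.
\<close>

definition encodes :: "nat list \<Rightarrow> 'a hypergraph \<Rightarrow> bool" where
  "encodes w H \<longleftrightarrow> (\<exists>num es.
     bij_betw num (verts H) {..<card (verts H)} \<and>
     (\<forall>e\<in>set es. distinct e) \<and>
     distinct (map set es) \<and>
     set (map set es) = (\<lambda>e. num ` e) ` edges H \<and>
     w = card (verts H) # length es # concat (map (\<lambda>e. length e # e) es))"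

lemma encodes_exists:
  assumes "hypergraph H"
  shows "\<exists>w. encodes w H"
proof -
  have fin: "finite (verts H)" "finite (edges H)"
    using assms by (auto simp: hypergraph_def intro: finite_subset)
  obtain num where num: "bij_betw num (verts H) {..<card (verts H)}"
    using ex_bij_betw_finite_nat[OF fin(1)] by (auto simp: atLeast0LessThan)
  obtain es where es: "set es = (\<lambda>e. num ` e) ` edges H" "distinct es"
    using finite_distinct_list fin(2) by (metis finite_imageI)
  have "set (sorted_list_of_set e) = e" if e: "e \<in> set es" for e
  proof (rule set_sorted_list_of_set)
    obtain d where d: "d \<in> edges H" "e = num ` d" using e es(1) by auto
    have "finite d" using assms d(1) by (auto simp: hypergraph_def dest: finite_subset)
    thus "finite e" using d(2) by simp
  qed
  hence "map set (map sorted_list_of_set es) = es"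
    by (simp add: map_idI)
  hence "encodes (card (verts H) # length (map sorted_list_of_set es) #
      concat (map (\<lambda>e. length e # e) (map sorted_list_of_set es))) H"
    unfolding encodes_def using num es
    by (intro exI[of _ num] exI[of _ "map sorted_list_of_set es"]) auto
  thus ?thesis ..
qed

definition initial_state :: "nat list \<Rightarrow> state" where
  "initial_state w = \<lparr>regs = (\<lambda>_. 0), mem = (\<lambda>i. if i < length w then w ! i else 0)\<rparr>"

fun outcome_code :: "outcome \<Rightarrow> nat" where
  "outcome_code Outcome_A = 0"
| "outcome_code Outcome_SL = 1"
| "outcome_code Outcome_E = 2"

text \<open>The result is read off register 0.\<close>

definition computes_within :: "com \<Rightarrow> nat list \<Rightarrow> nat \<Rightarrow> nat \<Rightarrow> bool" where
  "computes_within P w T r \<longleftrightarrow>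
     (\<exists>t s. exec P (initial_state w) t s \<and> t \<le> T \<and> regs s 0 = r)"

end

theory Submission
  imports Defs
begin

text \<open>
  Call a vertex forbidden if it forms an edge of size one, and consider the graph formed by the
  edges of size two.  As last player, Avoider must never create a forbidden vertex, so he wins
  iff nothing is forbidden initially and all degrees are at most one.  As second-to-last player
  he can afford exactly one forbidden vertex, left for Enforcer's last move.  If there is one
  already, he again needs maximum degree one on the rest.  If there is none, he wins iff the graph
  is \<open>avoidable\<close>: some single vertex deletion leaves maximum degree one, or the number of
  non-isolated vertices is odd and every deletion that makes this number even leads to a graph of
  the former kind.  The crucial point is that this class is closed under vertex deletion,
  independently of the number of isolated vertices.

  The conditions are formulas of first-order logic with a parity quantifier over the vertices.
  Every such formula compiles to a program that searches the vertices in nested loops and so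
  takes polynomial time.
\<close>

section \<open>Graphs of small degree\<close>

text \<open>The obstacle is waiting moves. A vertex that is isolated and not forbidden costs Avoider
  nothing, so he commits himself only when no such vertex is left. As second-to-last player he then
  faces an even number of vertices; with nothing forbidden the core is even and
  \<open>avoidable\<close> collapses to \<open>almost_matching\<close>. He picks a vertex whose only
  neighbour \<open>u\<close> is one whose deletion leaves a matching, and \<open>u\<close> becomes
  the forbidden vertex. Enforcer decides which other vertices disappear, hence the need for closure
  under deletion. Correctness of the conditions is backward analysis in four steps: whoever should
  win has a good move on turn, and whoever should lose has only bad ones. The algorithm must be an
  explicit program of the machine model with counted steps. One compiler for formulas, verified by
  induction, replaces a separate loop invariant for each graph condition; parity gets its own
  quantifier because it is not first-order definable.\<close>

definition adj :: "'a set set \<Rightarrow> 'a \<Rightarrow> 'a \<Rightarrow> bool" where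
  "adj E x y \<longleftrightarrow> x \<noteq> y \<and> {x, y} \<in> E"

definition matching :: "'a set set \<Rightarrow> 'a set \<Rightarrow> bool" where
  "matching E F \<longleftrightarrow> (\<forall>x\<in>F. \<forall>y\<in>F. \<forall>z\<in>F. adj E x y \<longrightarrow> adj E x z \<longrightarrow> y = z)"

definition core :: "'a set set \<Rightarrow> 'a set \<Rightarrow> 'a set" where
  "core E F = {x\<in>F. \<exists>y\<in>F. adj E x y}"

definition almost_matching :: "'a set set \<Rightarrow> 'a set \<Rightarrow> bool" where
  "almost_matching E F \<longleftrightarrow> (\<exists>u. matching E (F - {u}))"

text \<open>The second clause speaks of Enforcer's next pick \<open>v\<close>. If it leaves an even
  core, the isolated vertices are even in number with Avoider to move, so Enforcer can answer each
  waiting move by another and force a commitment. If it leaves an odd core, Avoider has an isolated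
  vertex to spare.\<close>

definition avoidable :: "'a set set \<Rightarrow> 'a set \<Rightarrow> bool" where
  "avoidable E F \<longleftrightarrow> almost_matching E F \<or>
     odd (card (core E F)) \<and>
     (\<forall>v. even (card (core E (F - {v}))) \<longrightarrow> almost_matching E (F - {v}))"

lemma adj_sym: "adj E x y \<Longrightarrow> adj E y x"
  by (auto simp: adj_def insert_commute)

lemma adj_irrefl [simp]: "\<not> adj E x x"
  by (simp add: adj_def)

lemma matching_mono: "matching E F \<Longrightarrow> G \<subseteq> F \<Longrightarrow> matching E G"
  unfolding matching_def by blast

lemma almost_matching_mono: "almost_matching E F \<Longrightarrow> G \<subseteq> F \<Longrightarrow> almost_matching E G"
  unfolding almost_matching_def by (meson Diff_mono matching_mono order_refl)

lemma core_mono: "G \<subseteq> F \<Longrightarrow> core E G \<subseteq> core E F"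
  unfolding core_def by blast

lemma core_subset: "core E F \<subseteq> F"
  unfolding core_def by blast

lemma finite_core: "finite F \<Longrightarrow> finite (core E F)"
  by (rule finite_subset[OF core_subset])

section \<open>Invariance under deleting isolated vertices\<close>

lemma not_core_iff:
  "v \<notin> core E F \<longleftrightarrow> (v \<in> F \<longrightarrow> (\<forall>y\<in>F. \<not> adj E v y \<and> \<not> adj E y v))"
  unfolding core_def using adj_sym[of E v] adj_sym[of E _ v] by blast

lemma core_remove_isolated: "v \<notin> core E F \<Longrightarrow> core E (F - {v}) = core E F"
  unfolding not_core_iff unfolding core_def by blast

lemma matching_remove_isolated: "v \<notin> core E F \<Longrightarrow> matching E (F - {v}) \<longleftrightarrow> matching E F"
  unfolding not_core_iff matching_def by blast

lemma almost_matching_remove_isolated: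
  assumes "v \<notin> core E F"
  shows "almost_matching E (F - {v}) \<longleftrightarrow> almost_matching E F"
proof -
  have "v \<notin> core E (F - {u})" for u
    using assms core_mono[of "F - {u}" F E] by auto
  then have "matching E (F - {v} - {u}) \<longleftrightarrow> matching E (F - {u})" for u
    by (metis Diff_insert2 insert_commute matching_remove_isolated)
  then show ?thesis by (simp add: almost_matching_def)
qed

lemma avoidable_remove_isolated:
  assumes "v \<notin> core E F"
  shows "avoidable E (F - {v}) \<longleftrightarrow> avoidable E F"
proof -
  have "core E (F - {v} - {x}) = core E (F - {x})"
    and "almost_matching E (F - {v} - {x}) \<longleftrightarrow> almost_matching E (F - {x})" for x
  proof -
    have "v \<notin> core E (F - {x})"
      using assms core_mono[of "F - {x}" F E] by auto
    moreover have "F - {v} - {x} = F - {x} - {v}" by auto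
    ultimately show "core E (F - {v} - {x}) = core E (F - {x})"
      and "almost_matching E (F - {v} - {x}) \<longleftrightarrow> almost_matching E (F - {x})"
      by (metis core_remove_isolated, metis almost_matching_remove_isolated)
  qed
  then show ?thesis
    using assms by (simp add: avoidable_def core_remove_isolated almost_matching_remove_isolated)
qed

lemma matching_imp_avoidable: "matching E F \<Longrightarrow> avoidable E F"
  unfolding avoidable_def almost_matching_def by (meson Diff_subset matching_mono)

lemma avoidable_even_core:
  "avoidable E F \<Longrightarrow> even (card (core E F)) \<Longrightarrow> almost_matching E F"
  by (auto simp: avoidable_def)

section \<open>Closure of avoidable graphs under deletion\<close>

text \<open>If every core vertex had a neighbour other than \<open>w\<close>, deleting
  \<open>w\<close> would remove just \<open>w\<close> from the core and flip its parity.\<close>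

lemma leaf_neighbour:
  assumes "finite F" "w \<in> core E F" "odd (card (core E F))" "odd (card (core E (F - {w})))"
  shows "\<exists>l\<in>F. adj E l w \<and> (\<forall>y\<in>F. adj E l y \<longrightarrow> y = w)"
proof (rule ccontr)
  assume "\<not> ?thesis"
  then have *: "\<exists>y\<in>F - {w}. adj E l y" if "l \<in> core E F" for l
    using that unfolding core_def by blast
  have "core E (F - {w}) = core E F - {w}"
  proof
    show "core E (F - {w}) \<subseteq> core E F - {w}" by (auto simp: core_def)
    show "core E F - {w} \<subseteq> core E (F - {w})"
    proof
      fix l assume l: "l \<in> core E F - {w}"
      then have "l \<in> F - {w}" using core_subset[of E F] by blast
      with *[of l] l show "l \<in> core E (F - {w})" unfolding core_def by blast
    qed
  qed
  moreover have "finite (core E F)"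
    using assms(1) by (rule finite_core)
  ultimately show False
    using assms by (simp add: card_Diff_singleton)
qed

text \<open>The edge \<open>{w, l}\<close> is a component, so deleting \<open>w\<close> takes
  exactly \<open>w\<close> and \<open>l\<close> out of the core.\<close>

lemma core_isolated_edge:
  assumes "finite F" "w \<in> F" "l \<in> F" "adj E l w"
    and "\<And>y. y \<in> F \<Longrightarrow> adj E l y \<Longrightarrow> y = w" "\<And>y. y \<in> F \<Longrightarrow> adj E w y \<Longrightarrow> y = l"
  shows "even (card (core E (F - {w}))) \<longleftrightarrow> even (card (core E F))"
proof -
  have "x \<in> core E (F - {w}) \<union> {w, l}" if xc: "x \<in> core E F" for x
  proof (rule ccontr)
    assume x: "x \<notin> core E (F - {w}) \<union> {w, l}"
    obtain y where "x \<in> F" "y \<in> F" "adj E x y"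
      using xc unfolding core_def by blast
    moreover have "y \<noteq> w"
      using assms(6)[of x] calculation x adj_sym[of E x y] by blast
    ultimately show False
      using x by (auto simp: core_def)
  qed
  moreover have "{w, l} \<subseteq> core E F"
    using assms(2-4) adj_sym[of E l w] unfolding core_def by blast
  ultimately have "core E F = core E (F - {w}) \<union> {w, l}"
    using core_mono[of "F - {w}" F E] by blast
  moreover have "w \<notin> core E (F - {w})"
    using core_subset[of E "F - {w}"] by blast
  moreover have "l \<notin> core E (F - {w})"
    using assms(5) unfolding core_def by blast
  moreover have "w \<noteq> l" using assms(4) by auto
  moreover have "finite (core E (F - {w}))"
    using assms(1) by (simp add: finite_core)
  ultimately show ?thesis
    by (simp add: card_insert_if)
qed

text \<open>The definition is silent only when \<open>w\<close> lies in the core and its deletion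
  keeps the core odd. Then a leaf \<open>l\<close> hangs at \<open>w\<close>, and the hypothesis is
  applied to other deletions: that of \<open>l\<close> if \<open>w\<close> has a further neighbour,
  and that of each relevant \<open>v\<close> if \<open>{w, l}\<close> is a component.\<close>

lemma avoidable_remove:
  assumes fin: "finite F" and av: "avoidable E F"
  shows "avoidable E (F - {w})"
proof (cases "w \<in> core E F \<and> odd (card (core E (F - {w}))) \<and> \<not> almost_matching E F")
  case False
  then show ?thesis
    using av avoidable_remove_isolated[of w E F] almost_matching_mono[of E F "F - {w}"]
    by (auto simp: avoidable_def)
next
  case True
  then have odd: "odd (card (core E F))"
    and am: "\<And>v. even (card (core E (F - {v}))) \<Longrightarrow> almost_matching E (F - {v})"
    using av by (auto simp: avoidable_def)
  obtain l where l: "l \<in> F" "adj E l w" "\<And>y. y \<in> F \<Longrightarrow> adj E l y \<Longrightarrow> y = w"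
    using leaf_neighbour[OF fin] True odd by metis
  have w: "w \<in> F" "w \<noteq> l" using True l(2) by (auto simp: core_def)
  show ?thesis
  proof (cases "\<exists>z\<in>F. z \<noteq> l \<and> adj E w z")
    \<comment> \<open>With a second neighbour of \<open>w\<close>, deleting the leaf
      \<open>l\<close> removes only \<open>l\<close> from the core and makes it even.\<close>
    case True
    then obtain z where z: "z \<in> F" "z \<noteq> l" "adj E w z" by blast
    have "x \<in> core E (F - {l})" if x: "x \<in> core E F" "x \<noteq> l" for x
    proof -
      obtain y where y: "x \<in> F" "y \<in> F" "adj E x y"
        using x unfolding core_def by blast
      show ?thesis
      proof (cases "y = l")
        case True
        then have "x = w" using l(3) y adj_sym[of E x y] by blast
        then show ?thesis using w z unfolding core_def by blast
      next
        case False
        then show ?thesis using x y unfolding core_def by blast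
      qed
    qed
    then have "core E (F - {l}) = core E F - {l}"
      using core_mono[of "F - {l}" F E] core_subset[of E "F - {l}"] by blast
    moreover have "l \<in> core E F" "finite (core E F)"
      using l(1,2) w(1) fin finite_core unfolding core_def by blast+
    ultimately have "even (card (core E (F - {l})))"
      using odd by (simp add: card_Diff_singleton)
    then obtain u where "matching E (F - {l} - {u})"
      using am by (auto simp: almost_matching_def)
    \<comment> \<open>Once \<open>w\<close> is gone, \<open>l\<close> is isolated and can be put
      back.\<close>
    then have "matching E (F - {w} - {u} - {l})"
      by (rule matching_mono) auto
    moreover have "l \<notin> core E (F - {w} - {u})"
      using l(3) unfolding core_def by blast
    ultimately have "matching E (F - {w} - {u})"
      by (simp add: matching_remove_isolated)
    then show ?thesis
      by (auto simp: avoidable_def almost_matching_def)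
  next
    \<comment> \<open>Now deleting \<open>w\<close> preserves the parity of the core of each
      \<open>F - {v}\<close> with \<open>v\<close> off the component \<open>{w, l}\<close>, so the
      condition for \<open>F - {w}\<close> is inherited from \<open>F\<close>.\<close>
    case False
    then have w': "\<And>y. y \<in> F \<Longrightarrow> adj E w y \<Longrightarrow> y = l" by blast
    have "almost_matching E (F - {w} - {v})" if ev: "even (card (core E (F - {w} - {v})))" for v
    proof -
      \<comment> \<open>Deleting \<open>l\<close> or \<open>w\<close> from \<open>F - {w}\<close>
        leaves its core odd, so \<open>v\<close> is neither.\<close>
      have "l \<notin> core E (F - {w})"
        using l(3) unfolding core_def by blast
      then have "core E (F - {w} - {l}) = core E (F - {w})"
        by (rule core_remove_isolated)
      moreover have "core E (F - {w} - {w}) = core E (F - {w})" by simp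
      ultimately have v: "v \<noteq> l" "v \<noteq> w" using ev True by metis+
      have eq: "F - {w} - {v} = F - {v} - {w}" by auto
      have "even (card (core E (F - {v} - {w}))) \<longleftrightarrow> even (card (core E (F - {v})))"
        using l(1,2) w v fin by (intro core_isolated_edge[where l = l]) (auto intro: l(3) w')
      then have "almost_matching E (F - {v})"
        using ev am eq by metis
      then show ?thesis
        by (rule almost_matching_mono) auto
    qed
    then show ?thesis
      using True by (simp add: avoidable_def)
  qed
qed

section \<open>Parity arguments that supply a vertex to pick\<close>

lemma perfect_matching_even:
  assumes "finite F" "matching E F" "core E F = F"
  shows "even (card F)"
  using assms
proof (induction F rule: finite_psubset_induct)
  case (psubset F)
  show ?case
  proof (cases "F = {}")
    case False
    then obtain x y where xy: "x \<in> F" "y \<in> F" "adj E x y"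
      using psubset.prems(2) unfolding core_def by blast
    have "x \<noteq> y" using xy by auto
    have "adj E z y \<Longrightarrow> z = x" "adj E z x \<Longrightarrow> z = y" if "z \<in> F" for z
      using that xy psubset.prems(1) adj_sym[of E z] adj_sym[of E x y] unfolding matching_def by blast+
    then have "core E (F - {x, y}) = F - {x, y}"
      using psubset.prems(2) unfolding core_def by blast
    moreover have "matching E (F - {x, y})"
      using psubset.prems(1) by (rule matching_mono) auto
    ultimately have "even (card (F - {x, y}))"
      using psubset.IH xy by blast
    moreover have "card F = card (F - {x, y}) + 2"
    proof -
      have "card (F - {x, y}) = card F - card {x, y}"
        using xy by (intro card_Diff_subset) auto
      moreover have "card {x, y} \<le> card F"
        using xy psubset.hyps by (intro card_mono) auto
      ultimately show ?thesis using \<open>x \<noteq> y\<close> by simp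
    qed
    ultimately show ?thesis by simp
  qed simp
qed

text \<open>This yields Avoider's committing move: picking \<open>v\<close> forbids exactly
  \<open>u\<close>. If no vertex depended on the deleted \<open>u\<close> alone,
  \<open>F - {u}\<close> would be perfectly matched, and \<open>F\<close> would have odd
  size.\<close>

lemma almost_matching_leaf:
  assumes fin: "finite F" and "F \<noteq> {}" "even (card F)" and core: "core E F = F"
    and am: "almost_matching E F"
  obtains v u where "v \<in> F" "{y\<in>F. adj E v y} = {u}" "matching E (F - {u})"
proof -
  obtain u where u: "matching E (F - {u})"
    using am by (auto simp: almost_matching_def)
  show ?thesis
  proof (cases "\<exists>v\<in>F. {y\<in>F. adj E v y} = {u}")
    case True
    then show ?thesis using u that by blast
  next
    case no: False
    show ?thesis
    proof (cases "u \<in> F")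
      case True
      have "\<exists>y\<in>F - {u}. adj E v y" if "v \<in> F - {u}" for v
      proof (rule ccontr)
        assume "\<not> (\<exists>y\<in>F - {u}. adj E v y)"
        moreover have "\<exists>y\<in>F. adj E v y" using that core by (auto simp: core_def)
        ultimately have "{y\<in>F. adj E v y} = {u}" by auto
        then show False using no that by blast
      qed
      then have "core E (F - {u}) = F - {u}" by (auto simp: core_def)
      then have "even (card (F - {u}))"
        using fin u perfect_matching_even by (metis finite_Diff)
      then show ?thesis
        using True fin assms(2,3) by (simp add: card_Diff_singleton)
    next
      case False
      \<comment> \<open>The deleted vertex lies outside \<open>F\<close>, so any vertex and its
        partner serve.\<close>
      then have m: "matching E F" using u by simp
      obtain v where v: "v \<in> F" using \<open>F \<noteq> {}\<close> by blast
      obtain y where y: "y \<in> F" "adj E v y" using v core by (auto simp: core_def)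
      have "{y\<in>F. adj E v y} = {y}"
        using m v y unfolding matching_def by blast
      moreover have "matching E (F - {y})" using m by (rule matching_mono) auto
      ultimately show ?thesis using v that by blast
    qed
  qed
qed

text \<open>Two edges at a common vertex occupy three vertices. Evenness forces a further one, which
  Enforcer can pick without destroying them.\<close>

lemma not_matching_spare_vertex:
  assumes "finite F" "\<not> matching E F" "even (card F)"
  obtains v where "v \<in> F" "\<not> matching E (F - {v})"
proof -
  obtain x y z where xyz: "x \<in> F" "y \<in> F" "z \<in> F" "adj E x y" "adj E x z" "y \<noteq> z"
    using assms(2) by (auto simp: matching_def)
  have "x \<noteq> y" "x \<noteq> z" using xyz by auto
  then have "F \<noteq> {x, y, z}" using xyz assms(3) by auto
  then obtain v where v: "v \<in> F" "v \<notin> {x, y, z}" using xyz by blast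
  then have "\<not> matching E (F - {v})"
    using xyz unfolding matching_def by auto
  then show ?thesis using v that by blast
qed

lemma graph_cong:
  assumes "\<And>x y. x \<in> F \<Longrightarrow> y \<in> F \<Longrightarrow> adj E x y \<longleftrightarrow> adj E' x y"
  shows "matching E F \<longleftrightarrow> matching E' F" "core E F = core E' F"
    "almost_matching E F \<longleftrightarrow> almost_matching E' F" "avoidable E F \<longleftrightarrow> avoidable E' F"
proof -
  have m: "matching E G \<longleftrightarrow> matching E' G" and c: "core E G = core E' G" if "G \<subseteq> F" for G
    using assms that unfolding matching_def core_def by (auto simp: subset_iff)
  have a: "almost_matching E G \<longleftrightarrow> almost_matching E' G" if "G \<subseteq> F" for G
    using m that unfolding almost_matching_def by (meson Diff_subset order_trans)
  show "matching E F \<longleftrightarrow> matching E' F" "core E F = core E' F"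
    "almost_matching E F \<longleftrightarrow> almost_matching E' F" "avoidable E F \<longleftrightarrow> avoidable E' F"
    using m c a by (simp_all add: avoidable_def)
qed


section \<open>The game on edges of size at most two\<close>

text \<open>Edges record what Avoider still lacks, so Enforcer's win shows as an empty edge.\<close>

fun move :: "player \<Rightarrow> 'a \<Rightarrow> 'a set set \<Rightarrow> 'a set set" where
  "move Avoider v E = (\<lambda>e. e - {v}) ` E"
| "move Enforcer v E = {e\<in>E. v \<notin> e}"

declare move.simps [simp del]

definition loops :: "'a set \<Rightarrow> 'a set set \<Rightarrow> 'a set" where
  "loops V E = {x\<in>V. {x} \<in> E}"

text \<open>Here \<open>p\<close> is to move and \<open>V\<close> holds the unpicked vertices; with
  an even number left, the mover does not make the last move.\<close>

definition avoider_second_to_last :: "player \<Rightarrow> 'a set \<Rightarrow> bool" where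
  "avoider_second_to_last p V \<longleftrightarrow> (p = Avoider \<longleftrightarrow> even (card V))"

definition last_win :: "'a set \<Rightarrow> 'a set set \<Rightarrow> bool" where
  "last_win V E \<longleftrightarrow> {} \<notin> E \<and> loops V E = {} \<and> matching E V"

definition second_to_last_win :: "'a set \<Rightarrow> 'a set set \<Rightarrow> bool" where
  "second_to_last_win V E \<longleftrightarrow> {} \<notin> E \<and>
     (loops V E = {} \<and> avoidable E V \<or> card (loops V E) = 1 \<and> matching E (V - loops V E))"

definition avoider_wins :: "player \<Rightarrow> 'a set \<Rightarrow> 'a set set \<Rightarrow> bool" where
  "avoider_wins p V E \<longleftrightarrow>
     (if avoider_second_to_last p V then second_to_last_win V E else last_win V E)"

lemma avoider_wins_iff:
  "avoider_wins p V E \<longleftrightarrow> {} \<notin> E \<and>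
     (if avoider_second_to_last p V
      then loops V E = {} \<and> avoidable E V \<or>
        card (loops V E) = 1 \<and> matching E (V - loops V E)
      else loops V E = {} \<and> matching E V)"
  by (simp add: avoider_wins_def second_to_last_win_def last_win_def)

definition position :: "'a set \<Rightarrow> 'a set set \<Rightarrow> bool" where
  "position V E \<longleftrightarrow> finite V \<and> E \<subseteq> Pow V \<and> (\<forall>e\<in>E. card e \<le> 2)"

lemma finite_loops: "finite V \<Longrightarrow> finite (loops V E)"
  by (simp add: loops_def)

section \<open>Effect of a single move\<close>

lemma position_move:
  assumes "position V E"
  shows "position (V - {v}) (move p v E)"
proof (cases p)
  case Avoider
  have "card (e - {v}) \<le> 2" if "e \<in> E" for e
    using assms that card_Diff1_le[of e v] unfolding position_def by (meson order_trans)
  then show ?thesis using assms Avoider by (auto simp: position_def move.simps)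
qed (use assms in \<open>auto simp: position_def move.simps\<close>)

text \<open>An edge that shrank to a pair \<open>{x, y}\<close> would have had three vertices, which
  \<open>position\<close> forbids. So the graph on the other vertices is the same whoever picks
  \<open>v\<close>.\<close>

lemma adj_move:
  assumes "position V E" "x \<noteq> v" "y \<noteq> v"
  shows "adj (move p v E) x y \<longleftrightarrow> adj E x y"
proof (cases p)
  case Avoider
  have "{x, y} \<in> E" if "x \<noteq> y" "e \<in> E" "e - {v} = {x, y}" for e
  proof (cases "v \<in> e")
    case True
    then have "e = {v, x, y}" using that by auto
    then have "card e = 3" using assms that by auto
    then show ?thesis using assms(1) that by (auto simp: position_def)
  qed (use that in auto)
  moreover have "{x, y} = {x, y} - {v}" using assms by auto
  ultimately show ?thesis
    using Avoider by (auto simp: adj_def image_iff move.simps)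
qed (use assms in \<open>auto simp: adj_def move.simps\<close>)

lemma graph_move:
  assumes "position V E" "v \<notin> F"
  shows "matching (move p v E) F \<longleftrightarrow> matching E F" "avoidable (move p v E) F \<longleftrightarrow> avoidable E F"
  using graph_cong[of F "move p v E" E] adj_move[OF assms(1), of _ v _ p] assms(2) by metis+

lemma matching_move:
  assumes "position V E" "matching E F" "G \<subseteq> F - {v}"
  shows "matching (move p v E) G"
  using assms graph_move(1)[of V E v G p] matching_mono[of E F G] by blast

lemma empty_in_move_Avoider: "{} \<in> move Avoider v E \<longleftrightarrow> {} \<in> E \<or> {v} \<in> E"
  by (auto simp: move.simps image_iff subset_singleton_iff)

lemma empty_in_move_Enforcer [simp]: "{} \<in> move Enforcer v E \<longleftrightarrow> {} \<in> E"
  by (simp add: move.simps)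

lemma loops_move_Enforcer: "loops (V - {v}) (move Enforcer v E) = loops V E - {v}"
  by (auto simp: loops_def move.simps)

lemma loops_move_Avoider:
  assumes "v \<in> V"
  shows "loops (V - {v}) (move Avoider v E) = loops V E - {v} \<union> {x\<in>V. adj E v x}"
proof -
  have "{x} \<in> move Avoider v E \<longleftrightarrow> {x} \<in> E \<or> {v, x} \<in> E" if "x \<noteq> v" for x
  proof
    assume "{x} \<in> move Avoider v E"
    then obtain e where e: "e \<in> E" "e - {v} = {x}" by (auto simp: move.simps)
    then have "e = {x} \<or> e = {v, x}" using that by auto
    then show "{x} \<in> E \<or> {v, x} \<in> E" using e by auto
  next
    have "{x} = {x} - {v}" "{x} = {v, x} - {v}" using that by auto
    then show "{x} \<in> E \<or> {v, x} \<in> E \<Longrightarrow> {x} \<in> move Avoider v E"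
      by (metis imageI move.simps(1))
  qed
  then show ?thesis by (auto simp: loops_def adj_def)
qed

lemma loops_move_Avoider_free:
  assumes "position V E" "v \<in> V - loops V E"
  defines "N \<equiv> {x\<in>V - loops V E. adj E v x}"
  shows "card (loops (V - {v}) (move Avoider v E)) = card (loops V E) + card N"
    and "V - {v} - loops (V - {v}) (move Avoider v E) = V - loops V E - {v} - N"
    and "N = {} \<Longrightarrow> loops V E = {} \<Longrightarrow> loops (V - {v}) (move Avoider v E) = {}"
proof -
  have *: "loops (V - {v}) (move Avoider v E) = loops V E \<union> N"
    using assms(2) unfolding N_def by (auto simp: loops_move_Avoider)
  have "finite V" using assms by (simp add: position_def)
  then show "card (loops (V - {v}) (move Avoider v E)) = card (loops V E) + card N"
    unfolding * by (intro card_Un_disjoint) (auto simp: N_def finite_loops)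
  show "V - {v} - loops (V - {v}) (move Avoider v E) = V - loops V E - {v} - N"
    unfolding * by auto
  show "N = {} \<Longrightarrow> loops V E = {} \<Longrightarrow> loops (V - {v}) (move Avoider v E) = {}"
    unfolding * by auto
qed

text \<open>Turn and parity change together, so the role stays fixed throughout a play.\<close>

lemma second_to_last_move:
  assumes "position V E" "v \<in> V"
  shows "avoider_second_to_last (opponent p) (V - {v}) \<longleftrightarrow> avoider_second_to_last p V"
proof -
  have "card V = Suc (card (V - {v}))"
    using assms by (metis card_Suc_Diff1 position_def)
  then show ?thesis
    by (cases p) (auto simp: avoider_second_to_last_def)
qed

section \<open>Backward analysis of winning positions\<close>

text \<open>A waiting move forbids no new vertex, and neither \<open>matching\<close> nor
  \<open>avoidable\<close> is affected by the loss of an isolated vertex.\<close>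

lemma avoider_move_isolated:
  assumes "position V E" "avoider_wins Avoider V E" "v \<in> V - loops V E" "v \<notin> core E (V - loops V E)"
  shows "avoider_wins Enforcer (V - {v}) (move Avoider v E)"
proof -
  let ?V = "V - {v}" and ?E = "move Avoider v E"
  have N: "{x\<in>V - loops V E. adj E v x} = {}"
    using assms(3,4) by (auto simp: not_core_iff)
  have e: "{} \<notin> ?E"
    using assms(2,3) by (simp add: empty_in_move_Avoider avoider_wins_iff loops_def)
  have l: "card (loops ?V ?E) = card (loops V E)" "loops V E = {} \<Longrightarrow> loops ?V ?E = {}"
    and F: "?V - loops ?V ?E = V - loops V E - {v}"
    using loops_move_Avoider_free[OF assms(1,3), unfolded N] by simp_all
  have "v \<in> V" using assms(3) by blast
  note s = second_to_last_move[OF assms(1) this, of Avoider, simplified]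
  have m: "matching ?E (?V - loops ?V ?E)" if "matching E (V - loops V E)"
    using assms(1) that by (rule matching_move) (simp add: F)
  have a: "avoidable ?E ?V" if "avoidable E V" "loops V E = {}"
    using that assms(1,4) by (subst graph_move) (auto simp: avoidable_remove_isolated)
  show ?thesis
    using assms(2) e l m a s unfolding avoider_wins_iff by (auto split: if_splits)
qed

text \<open>Without a waiting move, all vertices that are not forbidden lie in the core, so a
  matching on them means an even number. This excludes Avoider as last player, and as second-to-last
  player with one forbidden vertex. The remaining case is settled by
  \<open>almost_matching_leaf\<close>.\<close>

lemma avoider_has_move:
  assumes pos: "position V E" and win: "avoider_wins Avoider V E" and "V \<noteq> {}"
  shows "\<exists>v\<in>V. avoider_wins Enforcer (V - {v}) (move Avoider v E)"
proof (cases "core E (V - loops V E) = V - loops V E")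
  case False
  then obtain v where "v \<in> V - loops V E" "v \<notin> core E (V - loops V E)"
    using core_subset[of E "V - loops V E"] by blast
  then show ?thesis
    using avoider_move_isolated[OF pos win] by blast
next
  case True
  have fin: "finite V" using pos by (simp add: position_def)
  have nomatch: "even (card (V - loops V E))" if "matching E (V - loops V E)"
    using perfect_matching_even that True fin by blast
  have cV: "card V = card (V - loops V E) + card (loops V E)"
    using fin by (metis (no_types, lifting) add.commute card_Diff_subset card_mono finite_loops le_add_diff_inverse loops_def mem_Collect_eq subsetI)
  have st: "avoider_second_to_last Avoider V"
  proof (rule ccontr)
    assume "\<not> avoider_second_to_last Avoider V"
    then show False
      using win nomatch by (auto simp: avoider_wins_iff avoider_second_to_last_def)
  qed
  then have l: "loops V E = {}" and av: "avoidable E V"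
    using win nomatch cV by (auto simp: avoider_wins_iff avoider_second_to_last_def)
  have ev: "even (card V)" using st by (simp add: avoider_second_to_last_def)
  have core: "core E V = V" using True l by simp
  have am: "almost_matching E V"
    using avoidable_even_core[OF av] ev core by simp
  obtain v u where v: "v \<in> V" "{y\<in>V. adj E v y} = {u}" "matching E (V - {u})"
    using almost_matching_leaf[OF fin \<open>V \<noteq> {}\<close> ev core am] by blast
  have v': "v \<in> V - loops V E" and u: "{x\<in>V - loops V E. adj E v x} = {u}" using v l by simp_all
  note free = loops_move_Avoider_free[OF pos v', unfolded u]
  have "{} \<notin> move Avoider v E"
    using win l v by (auto simp: empty_in_move_Avoider avoider_wins_iff loops_def)
  moreover have "card (loops (V - {v}) (move Avoider v E)) = 1"
    using free(1) by (simp add: l)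
  moreover have "matching (move Avoider v E) (V - {v} - loops (V - {v}) (move Avoider v E))"
    using pos v(3) by (rule matching_move) (auto simp: free(2))
  moreover have "avoider_second_to_last Enforcer (V - {v})"
    using second_to_last_move[OF pos v(1), of Avoider] st by simp
  ultimately show ?thesis
    using v(1) by (auto simp: avoider_wins_iff)
qed

text \<open>For the graph, Enforcer's pick is a deletion, and the winning conditions survive
  deletions; the substantial case is \<open>avoidable_remove\<close>.\<close>

lemma enforcer_replies_keep_win:
  assumes pos: "position V E" and win: "avoider_wins Enforcer V E" and v: "v \<in> V"
  shows "avoider_wins Avoider (V - {v}) (move Enforcer v E)"
proof -
  let ?V = "V - {v}" and ?E = "move Enforcer v E"
  have fin: "finite V" using pos by (simp add: position_def)
  have e: "{} \<notin> ?E" using win by (simp add: avoider_wins_iff)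
  have l: "loops ?V ?E = loops V E - {v}" by (rule loops_move_Enforcer)
  note s = second_to_last_move[OF pos v, of Enforcer, simplified]
  have m: "matching ?E G" if "matching E F" "G \<subseteq> F - {v}" for F G
    using pos that by (rule matching_move)
  have a: "avoidable ?E ?V" if "avoidable E V"
    using that pos fin by (subst graph_move) (auto simp: avoidable_remove)
  show ?thesis
  proof (cases "avoider_second_to_last Enforcer V")
    case False
    then show ?thesis
      using win e l s m[of V ?V] unfolding avoider_wins_iff by auto
  next
    case st: True
    show ?thesis
    proof (cases "loops V E = {}")
      case True
      then show ?thesis using st win e l s a unfolding avoider_wins_iff by auto
    next
      case False
      then have c: "card (loops V E) = 1" and mt: "matching E (V - loops V E)"
        using st win by (auto simp: avoider_wins_iff)
      then obtain x where x: "loops V E = {x}" by (auto simp: card_1_singleton_iff)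
      show ?thesis
      proof (cases "v = x")
        \<comment> \<open>Enforcer took the forbidden vertex himself; the rest is a matching and
          hence avoidable.\<close>
        case True
        then show ?thesis
          using x e l s st m[OF mt, of ?V] matching_imp_avoidable[of ?E ?V]
          unfolding avoider_wins_iff by auto
      next
        case False
        then have "loops ?V ?E = {x}" using x l by auto
        then show ?thesis
          using x e s st m[OF mt, of "?V - {x}"] unfolding avoider_wins_iff by auto
      qed
    qed
  qed
qed

text \<open>Argued backwards: if the position after the move is won, so was the one before.
  Forbidden vertices only accumulate unless Avoider picks one and loses, so at most one was present
  or has arisen.\<close>

lemma avoider_moves_keep_loss:
  assumes pos: "position V E" and lose: "\<not> avoider_wins Avoider V E" and v: "v \<in> V"
  shows "\<not> avoider_wins Enforcer (V - {v}) (move Avoider v E)"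
proof (cases "{} \<in> E \<or> v \<in> loops V E")
  case True
  then show ?thesis
    by (auto simp: avoider_wins_iff empty_in_move_Avoider loops_def)
next
  case False
  let ?V = "V - {v}" and ?E = "move Avoider v E"
  let ?N = "{x\<in>V - loops V E. adj E v x}"
  have v': "v \<in> V - loops V E" using False v by blast
  have fin: "finite V" using pos by (simp add: position_def)
  note free = loops_move_Avoider_free[OF pos v']
  have iso: "v \<notin> core E (V - loops V E)" if "?N = {}"
    using that adj_sym[of E _ v] by (auto simp: not_core_iff)
  have s: "avoider_second_to_last Enforcer ?V \<longleftrightarrow> avoider_second_to_last Avoider V"
    using second_to_last_move[OF pos v, of Avoider] by simp
  have cN: "?N = {} \<longleftrightarrow> card ?N = 0" using fin by simp
  show ?thesis
  proof
    assume win: "avoider_wins Enforcer ?V ?E"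
    show False
    proof (cases "loops V E = {}")
      case True
      show False
      proof (cases "?N = {}")
        case N: True
        have "matching E V" if "matching ?E ?V"
          using that iso[OF N] True pos by (simp add: graph_move matching_remove_isolated)
        moreover have "avoidable E V" if "avoidable ?E ?V"
          using that iso[OF N] True pos by (simp add: graph_move avoidable_remove_isolated)
        ultimately show False
          using win lose False True free(3)[OF N True] s unfolding avoider_wins_iff by auto
      next
        \<comment> \<open>The new forbidden vertex \<open>u\<close> must be the only neighbour of
          \<open>v\<close>. Hence \<open>v\<close> is isolated in \<open>V - {u}\<close>, and
          deleting \<open>u\<close> already leaves a matching.\<close>
        case N: False
        have c: "card (loops ?V ?E) = card ?N" using free(1) True by simp
        then have "loops ?V ?E \<noteq> {}" using N cN by (metis card.empty)
        then have "card (loops ?V ?E) = 1" and m: "matching ?E (?V - loops ?V ?E)"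
          and st: "avoider_second_to_last Avoider V"
          using win s unfolding avoider_wins_iff by (auto split: if_splits)
        then have c: "card ?N = 1" using c by metis
        obtain u where u: "?N = {u}" using c by (auto simp: card_1_singleton_iff)
        have "matching E (V - {v} - {u})"
          using m pos True unfolding free(2) u by (simp add: graph_move)
        moreover have "v \<notin> core E (V - {u})"
          using u True by (auto simp: core_def)
        ultimately have "matching E (V - {u})"
          using matching_remove_isolated[of v E "V - {u}"]
          by (simp add: Diff_insert2[symmetric] insert_commute)
        then have "avoidable E V" by (auto simp: avoidable_def almost_matching_def)
        then show False
          using lose False True st unfolding avoider_wins_iff by auto
      qed
    next
      case nl: False
      then have ne: "card (loops V E) \<noteq> 0" using fin by (simp add: finite_loops)
      then have "loops ?V ?E \<noteq> {}" using free(1) by (metis add_is_0 card.empty)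
      then have "card (loops ?V ?E) = 1" and m: "matching ?E (?V - loops ?V ?E)"
        and "avoider_second_to_last Avoider V"
        using win s unfolding avoider_wins_iff by (auto split: if_splits)
      moreover from this have "card (loops V E) = 1" "card ?N = 0"
        using ne free(1) by linarith+
      moreover have "matching E (V - loops V E)"
      proof -
        have N: "?N = {}" using cN \<open>card ?N = 0\<close> by blast
        have "matching E (V - loops V E - {v})"
          using m pos unfolding free(2) N by (simp add: graph_move)
        then show ?thesis using iso[OF N] by (simp add: matching_remove_isolated)
      qed
      ultimately show False
        using lose False unfolding avoider_wins_iff by auto
    qed
  qed
qed

text \<open>Enforcer protects a witness of Avoider's defeat by picking outside it, and the parity of
  \<open>V\<close> provides room. If nothing is forbidden and Avoider is second-to-last, the
  definition of \<open>avoidable\<close> itself names the move.\<close>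

lemma enforcer_has_move:
  assumes pos: "position V E" and lose: "\<not> avoider_wins Enforcer V E" and ne: "V \<noteq> {}"
  shows "\<exists>v\<in>V. \<not> avoider_wins Avoider (V - {v}) (move Enforcer v E)"
proof (cases "{} \<in> E")
  case True
  then show ?thesis using ne by (auto simp: avoider_wins_iff)
next
  case e: False
  have fin: "finite V" using pos by (simp add: position_def)
  have s: "avoider_second_to_last Avoider (V - {v}) \<longleftrightarrow> avoider_second_to_last Enforcer V"
    if "v \<in> V" for v
    using second_to_last_move[OF pos that, of Enforcer] by simp
  have mm: "\<not> matching (move Enforcer v E) (F - {v})" if "\<not> matching E (F - {v})" for F v
    using that pos by (simp add: graph_move)
  have lo: "loops V E \<subseteq> V" by (auto simp: loops_def)
  then have cV: "card V = card (V - loops V E) + card (loops V E)"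
    using fin by (metis Diff_partition Un_Diff_cancel2 card_Un_disjoint Diff_disjoint add.commute finite_subset finite_Diff)
  show ?thesis
  proof (cases "avoider_second_to_last Enforcer V")
    case False
    then have ev: "even (card V)" by (simp add: avoider_second_to_last_def)
    show ?thesis
    proof (cases "loops V E = {}")
      case True
      then have "\<not> matching E V"
        using lose e False by (auto simp: avoider_wins_iff)
      then obtain v where v: "v \<in> V" "\<not> matching E (V - {v})"
        using not_matching_spare_vertex fin ev by blast
      then show ?thesis
        using mm s False unfolding avoider_wins_iff by auto
    next
      case nl: False
      then obtain x where x: "x \<in> loops V E" by blast
      have "V \<noteq> {x}" using ev by auto
      then obtain v where v: "v \<in> V" "v \<noteq> x" using x lo by blast
      then have "loops (V - {v}) (move Enforcer v E) \<noteq> {}"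
        using x by (auto simp: loops_move_Enforcer)
      then show ?thesis
        using v s False unfolding avoider_wins_iff by auto
    qed
  next
    case st: True
    then have odd: "odd (card V)" by (simp add: avoider_second_to_last_def)
    consider "loops V E = {}" | "card (loops V E) = 1" | "card (loops V E) \<ge> 2"
      using fin finite_loops[of V E]
      by (metis One_nat_def Suc_1 Suc_leI card_0_eq le_neq_implies_less not_less_eq_eq le_0_eq)
    then show ?thesis
    proof cases
      case 1
      then have na: "\<not> avoidable E V"
        using lose e st by (auto simp: avoider_wins_iff)
      \<comment> \<open>If \<open>core E V = V\<close>, the core is odd, so a violated second clause
        gives a deletion with even core that is not almost a matching, hence not avoidable.
        Otherwise an isolated vertex is a neutral pick.\<close>
      have "\<exists>v\<in>V. \<not> avoidable E (V - {v})"
      proof (cases "core E V = V")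
        case True
        then obtain v where v: "even (card (core E (V - {v})))" "\<not> almost_matching E (V - {v})"
          using na odd by (auto simp: avoidable_def)
        then have "v \<in> V" using True odd by (metis Diff_empty Diff_insert0)
        moreover have "\<not> avoidable E (V - {v})"
          using v by (auto simp: avoidable_def)
        ultimately show ?thesis by blast
      next
        case False
        then obtain v where "v \<in> V" "v \<notin> core E V" using core_subset[of E V] by blast
        then show ?thesis using na avoidable_remove_isolated[of v E V] by blast
      qed
      then obtain v where v: "v \<in> V" "\<not> avoidable E (V - {v})" by blast
      moreover have "\<not> avoidable (move Enforcer v E) (V - {v})"
        using v pos by (simp add: graph_move)
      moreover have "loops (V - {v}) (move Enforcer v E) = {}"
        using 1 by (simp add: loops_move_Enforcer)
      ultimately show ?thesis
        using s st by (intro bexI[of _ v]) (auto simp: avoider_wins_iff)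
    next
      case 2
      then obtain x where x: "loops V E = {x}" by (auto simp: card_1_singleton_iff)
      have "\<not> matching E (V - {x})"
        using lose e st x by (auto simp: avoider_wins_iff)
      moreover have "even (card (V - {x}))"
        using odd cV 2 x by simp
      ultimately obtain v where v: "v \<in> V - {x}" "\<not> matching E (V - {x} - {v})"
        using not_matching_spare_vertex fin by blast
      moreover have "loops (V - {v}) (move Enforcer v E) = {x}"
        using v x by (auto simp: loops_move_Enforcer)
      moreover have "V - {v} - {x} = V - {x} - {v}" by auto
      ultimately show ?thesis
        using mm[of "V - {x}" v] s st
        by (intro bexI[of _ v]) (auto simp: avoider_wins_iff)
    next
      case 3
      obtain v where v: "v \<in> V" "card (loops V E - {v}) \<ge> 2"
      proof (cases "loops V E = V")
        case True
        then obtain v where "v \<in> V" using ne by blast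
        \<comment> \<open>Oddness turns two forbidden vertices into three, so two survive any
          pick.\<close>
        moreover have "card V \<ge> 3" using 3 True odd by (cases "card V = 2") auto
        ultimately show ?thesis using that[of v] fin True by (simp add: card_Diff_singleton)
      next
        case False
        then obtain v where "v \<in> V" "v \<notin> loops V E" using lo by blast
        then show ?thesis using that[of v] 3 by simp
      qed
      then have c: "card (loops (V - {v}) (move Enforcer v E)) \<ge> 2"
        by (simp add: loops_move_Enforcer)
      then have "loops (V - {v}) (move Enforcer v E) \<noteq> {}" by auto
      then show ?thesis
        using c v(1) by (intro bexI[of _ v]) (auto simp: avoider_wins_iff)
    qed
  qed
qed

lemma avoider_wins_final: "position {} E \<Longrightarrow> avoider_wins p {} E \<longleftrightarrow> {} \<notin> E"
  by (auto simp: avoider_wins_iff loops_def avoidable_def almost_matching_def matching_def)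

section \<open>From invariants on positions to strategies on histories\<close>

text \<open>Closed form of the edge set obtained by applying \<open>move\<close> along the history
  \<open>h\<close>.\<close>

definition residual :: "player \<Rightarrow> 'a hypergraph \<Rightarrow> 'a list \<Rightarrow> 'a set set" where
  "residual f H h = (\<lambda>e. e - picks f Avoider h) ` {e\<in>edges H. e \<inter> picks f Enforcer h = {}}"

lemma picks_Nil [simp]: "picks f p [] = {}"
  by (simp add: picks_def)

lemma picks_snoc:
  fixes v :: 'a
  shows
  "picks f p (h @ [v]) = picks f p h \<union> (if turn f (length h) = p then {v} else {})"
proof -
  have image: "picks f p vs = (!) vs ` {i. i < length vs \<and> turn f i = p}" for vs :: "'a list"
    by (auto simp: picks_def)
  have "{i. i < Suc n \<and> turn f i = p} =
      {i. i < n \<and> turn f i = p} \<union> (if turn f n = p then {n} else {})" for n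
    by (auto simp: less_Suc_eq)
  moreover have "(!) (h @ [v]) ` {i. i < length h \<and> turn f i = p} =
      (!) h ` {i. i < length h \<and> turn f i = p}"
    by (rule image_cong) (simp_all add: nth_append)
  ultimately show ?thesis
    by (simp add: image image_Un)
qed

lemma picks_subset: "picks f p h \<subseteq> set h"
  by (auto simp: picks_def)

lemma picks_disjoint: "distinct h \<Longrightarrow> picks f Avoider h \<inter> picks f Enforcer h = {}"
  by (auto simp: picks_def nth_eq_iff_index_eq)

lemma residual_snoc:
  assumes "v \<notin> set h"
  shows "residual f H (h @ [v]) = move (turn f (length h)) v (residual f H h)"
proof -
  let ?A = "picks f Avoider h" and ?B = "picks f Enforcer h"
  have v: "v \<notin> ?A" using assms picks_subset[of f Avoider h] by blast
  show ?thesis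
  proof (cases "turn f (length h)")
    case Avoider
    have "e - insert v ?A = e - ?A - {v}" for e by blast
    with Avoider show ?thesis
      by (simp add: residual_def picks_snoc move.simps image_image)
  next
    case Enforcer
    have "{e \<in> edges H. e \<inter> insert v ?B = {}} = {e \<in> {e \<in> edges H. e \<inter> ?B = {}}. v \<notin> e - ?A}"
      using v by blast
    then have "(\<lambda>e. e - ?A) ` {e \<in> edges H. e \<inter> insert v ?B = {}} =
        {d \<in> (\<lambda>e. e - ?A) ` {e \<in> edges H. e \<inter> ?B = {}}. v \<notin> d}"
      by blast
    with Enforcer show ?thesis
      by (simp add: residual_def picks_snoc move.simps)
  qed
qed

lemma empty_in_residual:
  assumes "vs \<in> plays H" "hypergraph H"
  shows "{} \<in> residual f H vs \<longleftrightarrow> (\<exists>e\<in>edges H. e \<subseteq> picks f Avoider vs)"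
proof -
  have "picks f Avoider vs \<inter> picks f Enforcer vs = {}"
    using assms picks_disjoint by (auto simp: plays_def)
  then show ?thesis
    unfolding residual_def by (auto simp: image_iff; blast)
qed

lemma turn_Suc: "turn f (Suc i) = opponent (turn f i)"
  by (cases f) (auto simp: turn_def)

text \<open>Choosing a vertex that preserves \<open>I\<close> on each own turn carries the invariant
  to the end of the play, where \<open>final\<close> names the winner. The first argument of
  \<open>I\<close> is the player to move.\<close>

lemma winning_strategy_from_invariant:
  assumes H: "hypergraph H"
    and init: "I f (verts H) (edges H)"
    and move: "\<And>V E. I p V E \<Longrightarrow> V \<noteq> {} \<Longrightarrow> \<exists>v\<in>V. I (opponent p) (V - {v}) (move p v E)"
    and reply: "\<And>V E v. I (opponent p) V E \<Longrightarrow> v \<in> V \<Longrightarrow>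
      I p (V - {v}) (move (opponent p) v E)"
    and final: "\<And>q E. I q {} E \<Longrightarrow> {} \<in> E \<longleftrightarrow> p = Enforcer"
  shows "has_winning_strategy H f p"
proof -
  define good where "good h v \<longleftrightarrow> v \<in> verts H - set h \<and>
    I (opponent p) (verts H - set h - {v}) (move p v (residual f H h))" for h v
  \<comment> \<open>The fallback makes \<open>\<sigma>\<close> legal on every history, as
    \<open>legal_strategy\<close> demands, even where no good vertex exists.\<close>
  define \<sigma> where "\<sigma> h = (if \<exists>v. good h v then SOME v. good h v else SOME v. v \<in> verts H - set h)" for h
  have "\<sigma> h \<in> verts H - set h" if "set h \<subset> verts H" for h
  proof (cases "\<exists>v. good h v")
    case True
    then have "good h (\<sigma> h)" by (simp add: \<sigma>_def someI_ex)
    then show ?thesis by (simp add: good_def)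
  next
    case False
    have "\<exists>v. v \<in> verts H - set h" using that by blast
    then show ?thesis using False unfolding \<sigma>_def by (metis (mono_tags, lifting) someI_ex)
  qed
  then have legal: "legal_strategy H \<sigma>"
    by (simp add: legal_strategy_def)
  have "wins_play H f p vs" if vs: "vs \<in> plays H" and fol: "follows f p \<sigma> vs" for vs
  proof -
    have d: "distinct vs" "set vs = verts H" using vs by (auto simp: plays_def)
    have "I (turn f i) (verts H - set (take i vs)) (residual f H (take i vs))" if "i \<le> length vs" for i
      using that
    proof (induction i)
      case 0
      have "residual f H [] = edges H" by (simp add: residual_def)
      then show ?case using init by (simp add: turn_def)
    next
      case (Suc i)
      let ?h = "take i vs"
      have i: "i < length vs" using Suc.prems by simp
      then have tk: "take (Suc i) vs = ?h @ [vs ! i]" by (rule take_Suc_conv_app_nth)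
      have "distinct (take (Suc i) vs)" using d by (intro distinct_take)
      then have v: "vs ! i \<notin> set ?h" "vs ! i \<in> verts H"
        using i nth_mem[OF i] d(2) by (simp_all add: tk)
      have IH: "I (turn f i) (verts H - set ?h) (residual f H ?h)" using Suc i by simp
      have V: "verts H - set (take (Suc i) vs) = verts H - set ?h - {vs ! i}"
        unfolding tk by auto
      have R: "residual f H (take (Suc i) vs) = move (turn f i) (vs ! i) (residual f H ?h)"
        unfolding tk using residual_snoc[OF v(1), of f H] i by simp
      show ?case
      proof (cases "turn f i = p")
        case True
        have "verts H - set ?h \<noteq> {}" using v by blast
        then have "\<exists>v. good ?h v"
          using move[of "verts H - set ?h" "residual f H ?h"] IH True unfolding good_def by blast
        then have "good ?h (\<sigma> ?h)" by (simp add: \<sigma>_def someI_ex)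
        moreover have "vs ! i = \<sigma> ?h" using fol i True by (simp add: follows_def)
        ultimately show ?thesis
          using True unfolding V R turn_Suc good_def by simp
      next
        case False
        then have "turn f i = opponent p" "opponent (opponent p) = p"
          by (cases p; cases "turn f i"; simp)+
        then show ?thesis
          using reply[of "verts H - set ?h" "residual f H ?h" "vs ! i"] IH v
          unfolding V R turn_Suc by simp
      qed
    qed
    from this[of "length vs"] have "{} \<in> residual f H vs \<longleftrightarrow> p = Enforcer"
      using final d(2) by simp
    then show ?thesis
      using empty_in_residual[OF vs H] by (cases p) auto
  qed
  then show ?thesis using legal unfolding has_winning_strategy_def by blast
qed

text \<open>\<open>avoider_wins\<close> and its negation are invariants for Avoider and Enforcer;
  the converses hold because both players cannot win.\<close>

lemma has_winning_strategy_iff: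
  assumes "hypergraph H" "rank_le 2 H"
  shows "has_winning_strategy H f Avoider \<longleftrightarrow> avoider_wins f (verts H) (edges H)"
    and "has_winning_strategy H f Enforcer \<longleftrightarrow> \<not> avoider_wins f (verts H) (edges H)"
proof -
  have pos: "position (verts H) (edges H)"
    using assms by (auto simp: position_def hypergraph_def rank_le_def)
  have "has_winning_strategy H f Avoider" if "avoider_wins f (verts H) (edges H)"
    using assms(1)
  proof (rule winning_strategy_from_invariant[where I = "\<lambda>p V E. position V E \<and> avoider_wins p V E"])
    show "\<exists>v\<in>V. position (V - {v}) (move Avoider v E) \<and>
        avoider_wins (opponent Avoider) (V - {v}) (move Avoider v E)"
      if "position V E \<and> avoider_wins Avoider V E" "V \<noteq> {}" for V E
      using that avoider_has_move[of V E] position_move[of V E] by (auto)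
  qed (use pos that position_move enforcer_replies_keep_win in
        \<open>auto simp: avoider_wins_final\<close>)
  moreover have "has_winning_strategy H f Enforcer" if "\<not> avoider_wins f (verts H) (edges H)"
    using assms(1)
  proof (rule winning_strategy_from_invariant[where I = "\<lambda>p V E. position V E \<and> \<not> avoider_wins p V E"])
    show "\<exists>v\<in>V. position (V - {v}) (move Enforcer v E) \<and>
        \<not> avoider_wins (opponent Enforcer) (V - {v}) (move Enforcer v E)"
      if "position V E \<and> \<not> avoider_wins Enforcer V E" "V \<noteq> {}" for V E
      using that enforcer_has_move[of V E] position_move[of V E] by (auto)
    show "position (V - {v}) (move (opponent Enforcer) v E) \<and>
        \<not> avoider_wins Enforcer (V - {v}) (move (opponent Enforcer) v E)"
      if "position V E \<and> \<not> avoider_wins (opponent Enforcer) V E" "v \<in> V" for V E v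
      using that avoider_moves_keep_loss[of V E v] position_move[of V E] by simp
  qed (use pos that in
        \<open>auto simp: avoider_wins_final\<close>)
  moreover have "\<not> (has_winning_strategy H f Avoider \<and> has_winning_strategy H f Enforcer)"
    using assms(1) by (intro not_both_win) (simp add: hypergraph_def)
  ultimately show "has_winning_strategy H f Avoider \<longleftrightarrow> avoider_wins f (verts H) (edges H)"
    and "has_winning_strategy H f Enforcer \<longleftrightarrow> \<not> avoider_wins f (verts H) (edges H)"
    by blast+
qed

text \<open>Enforcer's result in one role negates Avoider's in the other. Since
  \<open>last_win\<close> implies \<open>second_to_last_win\<close>, only three combinations
  occur.\<close>

lemma has_outcome_computed:
  assumes "hypergraph H" "rank_le 2 H"
  shows "has_outcome H
    (if second_to_last_win (verts H) (edges H)
     then if last_win (verts H) (edges H) then Outcome_A else Outcome_SL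
     else Outcome_E)"
proof -
  have "last_win (verts H) (edges H) \<Longrightarrow> second_to_last_win (verts H) (edges H)"
    by (auto simp: last_win_def second_to_last_win_def matching_imp_avoidable)
  then show ?thesis
    by (auto simp: wins_as_last_def wins_as_second_to_last_def has_winning_strategy_iff[OF assms]
        avoider_wins_def avoider_second_to_last_def)
qed


section \<open>Compiling first-order logic with parity\<close>

text \<open>An upper bound in place of the exact step count lets branches of different length share
  one bound.\<close>

definition runs :: "com \<Rightarrow> state \<Rightarrow> nat \<Rightarrow> state \<Rightarrow> bool" where
  "runs P s T s' \<longleftrightarrow> (\<exists>t\<le>T. exec P s t s')"

lemma runs_mono: "runs P s T s' \<Longrightarrow> T \<le> T' \<Longrightarrow> runs P s T' s'"
  unfolding runs_def by (meson order_trans)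

lemma runs_Suc_0: "exec P s (Suc 0) s' \<Longrightarrow> runs P s (Suc 0) s'"
  unfolding runs_def by blast

lemma runs_Seq: "runs P s T s' \<Longrightarrow> runs Q s' U s'' \<Longrightarrow> runs (Seq P Q) s (T + U) s''"
  unfolding runs_def by (meson add_mono exec.Seq)

lemma runs_CondTrue: "holds b s \<Longrightarrow> runs P s T s' \<Longrightarrow> runs (Cond b P Q) s (1 + T) s'"
  unfolding runs_def by (meson add_left_mono exec.CondTrue)

lemma runs_CondFalse: "\<not> holds b s \<Longrightarrow> runs Q s T s' \<Longrightarrow> runs (Cond b P Q) s (1 + T) s'"
  unfolding runs_def by (meson add_left_mono exec.CondFalse)

lemma runs_WhileFalse: "\<not> holds b s \<Longrightarrow> runs (While b P) s 1 s"
  unfolding runs_def by (meson exec.WhileFalse order_refl)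

lemma runs_WhileTrue:
  "holds b s \<Longrightarrow> runs P s T s' \<Longrightarrow> runs (While b P) s' U s'' \<Longrightarrow>
    runs (While b P) s (1 + T + U) s''"
  unfolding runs_def by (meson add_mono exec.WhileTrue order_refl)

fun loop_free :: "com \<Rightarrow> bool" where
  "loop_free (While b P) \<longleftrightarrow> False"
| "loop_free (Seq P Q) \<longleftrightarrow> loop_free P \<and> loop_free Q"
| "loop_free (Cond b P Q) \<longleftrightarrow> loop_free P \<and> loop_free Q"
| "loop_free _ \<longleftrightarrow> True"

text \<open>Together with \<open>cost\<close> this lets the simplifier execute loop-free code, so
  that only loops need induction.\<close>

fun run :: "com \<Rightarrow> state \<Rightarrow> state" where
  "run Skip s = s"
| "run (Const x k) s = s\<lparr>regs := (regs s)(x := k)\<rparr>"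
| "run (Add x y z) s = s\<lparr>regs := (regs s)(x := regs s y + regs s z)\<rparr>"
| "run (Sub x y z) s = s\<lparr>regs := (regs s)(x := regs s y - regs s z)\<rparr>"
| "run (Load x y) s = s\<lparr>regs := (regs s)(x := mem s (regs s y))\<rparr>"
| "run (Store x y) s = s\<lparr>mem := (mem s)(regs s x := regs s y)\<rparr>"
| "run (Seq P Q) s = run Q (run P s)"
| "run (Cond b P Q) s = (if holds b s then run P s else run Q s)"
| "run (While b P) s = s"

fun cost :: "com \<Rightarrow> nat" where
  "cost (Seq P Q) = cost P + cost Q"
| "cost (Cond b P Q) = 1 + max (cost P) (cost Q)"
| "cost _ = 1"

lemma runs_loop_free: "loop_free P \<Longrightarrow> runs P s (cost P) (run P s)"
proof (induction P arbitrary: s)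
  case (Seq P Q)
  then show ?case by (auto intro: runs_Seq)
next
  case (Cond b P Q)
  then have "runs P s (max (cost P) (cost Q)) (run P s)" "runs Q s (max (cost P) (cost Q)) (run Q s)"
    by (auto intro: runs_mono[OF Cond.IH(1)] runs_mono[OF Cond.IH(2)])
  then show ?case
    using runs_CondTrue[of b s P _ _ Q] runs_CondFalse[of b s Q _ _ P] by fastforce
qed (simp_all add: runs_Suc_0 exec.intros(1-6)[simplified])

lemma runs_loop_freeI: "loop_free P \<Longrightarrow> cost P = T \<Longrightarrow> run P s = s' \<Longrightarrow> runs P s T s'"
  using runs_loop_free by blast

fun seqs :: "com list \<Rightarrow> com" where
  "seqs [] = Skip"
| "seqs (P # Ps) = Seq P (seqs Ps)"

text \<open>Register 0 holds results, 1 the constant 1, 2 the number of vertices, 3 the number of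
  edges, 4 the constant 0; registers 5 to 9 are scratch space for scanning the edge list.\<close>

abbreviation var :: "nat \<Rightarrow> reg" where "var d \<equiv> 10 + 2 * d"
abbreviation acc :: "nat \<Rightarrow> reg" where "acc d \<equiv> 11 + 2 * d"

text \<open>A frame condition: for \<open>k = var d\<close> it protects the variables and
  accumulators of the enclosing quantifiers. Required for all \<open>k\<close>, it leaves only
  register 0 and the scratch registers free.\<close>

definition keeps :: "nat \<Rightarrow> state \<Rightarrow> state \<Rightarrow> bool" where
  "keeps k s s' \<longleftrightarrow> mem s' = mem s \<and>
     (\<forall>r. 1 \<le> r \<and> r \<le> 4 \<or> 10 \<le> r \<and> r < k \<longrightarrow> regs s' r = regs s r)"

lemma keeps_trans: "keeps k s s' \<Longrightarrow> keeps k s' s'' \<Longrightarrow> keeps k s s''"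
  by (auto simp: keeps_def)

section \<open>Scanning the edge list\<close>

definition edge_words :: "nat list list \<Rightarrow> nat list" where
  "edge_words es = concat (map (\<lambda>e. length e # e) es)"

definition stored :: "(nat \<Rightarrow> nat) \<Rightarrow> nat \<Rightarrow> nat list \<Rightarrow> bool" where
  "stored M p xs \<longleftrightarrow> (\<forall>j<length xs. M (p + j) = xs ! j)"

lemma stored_Cons: "stored M p (x # xs) \<longleftrightarrow> M p = x \<and> stored M (Suc p) xs"
  unfolding stored_def by (auto simp: less_Suc_eq_0_disj nth_Cons split: nat.splits)

lemma stored_append: "stored M p (xs @ ys) \<longleftrightarrow> stored M p xs \<and> stored M (p + length xs) ys"
proof (induction xs arbitrary: p)
  case Nil
  then show ?case by (simp add: stored_def)
qed (simp add: stored_Cons)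

text \<open>Registers 8 and 9 are loaded whatever the size, so for short edges they may hold
  unrelated words; the checks consult the size in register 7. The pointer advances by the size plus
  one.\<close>

definition read_edge :: com where
  "read_edge = seqs [Load 7 6, Add 6 6 1, Load 8 6, Add 6 6 1, Load 9 6, Add 6 6 7, Sub 6 6 1,
     Sub 5 5 1]"

definition scan :: "com \<Rightarrow> com" where
  "scan chk = seqs [Const 0 0, Add 5 3 4, Const 6 2, While (Less 4 5) (Seq read_edge chk)]"

text \<open>The contract of a loop body: register 0 is raised to 1 but never cleared, so it
  accumulates a disjunction over the edges.\<close>

definition checks :: "state \<Rightarrow> com \<Rightarrow> (nat list \<Rightarrow> bool) \<Rightarrow> bool" where
  "checks s0 chk Q \<longleftrightarrow> loop_free chk \<and>
     (\<forall>s e. (\<forall>k. keeps k s0 s) \<longrightarrow> length e \<le> 2 \<longrightarrow> distinct e \<longrightarrow> regs s 7 = length e \<longrightarrow>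
        (\<forall>x. e = [x] \<longrightarrow> regs s 8 = x) \<longrightarrow> (\<forall>x y. e = [x, y] \<longrightarrow> regs s 8 = x \<and> regs s 9 = y) \<longrightarrow>
        (\<forall>k. keeps k s (run chk s)) \<and> regs (run chk s) 5 = regs s 5 \<and>
        regs (run chk s) 6 = regs s 6 \<and>
        regs (run chk s) 0 = (if Q e then 1 else regs s 0))"

text \<open>A round costs one test, nine steps of \<open>read_edge\<close> (including its closing
  \<open>Skip\<close>) and the check.\<close>

lemma scan_loop:
  assumes chk: "checks s0 chk Q"
    and one: "regs s0 1 = 1" and zero: "regs s0 4 = 0"
  shows "(\<forall>e\<in>set es. length e \<le> 2 \<and> distinct e) \<Longrightarrow> \<forall>k. keeps k s0 s \<Longrightarrow>
    stored (mem s0) (regs s 6) (edge_words es) \<Longrightarrow> regs s 5 = length es \<Longrightarrow>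
    \<exists>s'. runs (While (Less 4 5) (Seq read_edge chk)) s (length es * (cost chk + 10) + 1) s' \<and>
      (\<forall>k. keeps k s0 s') \<and> regs s' 0 = (if \<exists>e\<in>set es. Q e then 1 else regs s 0)"
proof (induction es arbitrary: s)
  case Nil
  have "regs s 4 = 0" using Nil.prems(2) zero by (simp add: keeps_def)
  then have "\<not> holds (Less 4 5) s" using Nil by simp
  then have "runs (While (Less 4 5) (Seq read_edge chk)) s 1 s" by (rule runs_WhileFalse)
  then show ?case using Nil by auto
next
  case (Cons e es)
  have regs: "regs s 4 = 0" "regs s 1 = 1" and mem: "mem s = mem s0"
    using Cons.prems(2) zero one by (simp_all add: keeps_def)
  define s1 where "s1 = run read_edge s"
  have e: "length e \<le> 2" "distinct e" using Cons.prems(1) by simp_all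
  have st: "mem s0 (regs s 6) = length e" "stored (mem s0) (Suc (regs s 6)) e"
    "stored (mem s0) (Suc (regs s 6) + length e) (edge_words es)"
    using Cons.prems(3) by (simp_all add: edge_words_def stored_Cons stored_append)
  have k1: "\<forall>k. keeps k s0 s1"
    using Cons.prems(2) by (auto simp: keeps_def s1_def read_edge_def)
  have r1: "regs s1 7 = length e" "regs s1 6 = Suc (regs s 6) + length e" "regs s1 5 = length es"
    "regs s1 0 = regs s 0"
    "regs s1 8 = mem s0 (Suc (regs s 6))" "regs s1 9 = mem s0 (Suc (Suc (regs s 6)))"
    using regs mem st(1) Cons.prems(4) by (simp_all add: s1_def read_edge_def)
  define s2 where "s2 = run chk s1"
  have "(\<forall>k. keeps k s1 s2) \<and> regs s2 5 = regs s1 5 \<and> regs s2 6 = regs s1 6 \<and>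
      regs s2 0 = (if Q e then 1 else regs s1 0)"
  proof -
    have "e = [x] \<Longrightarrow> regs s1 8 = x" and "e = [x, y] \<Longrightarrow> regs s1 8 = x \<and> regs s1 9 = y" for x y
      using st(2) r1(5,6) by (simp_all add: stored_Cons)
    then show ?thesis
      using chk k1 e r1(1) unfolding checks_def s2_def by blast
  qed
  then have s2: "\<forall>k. keeps k s0 s2" "regs s2 5 = length es"
      "regs s2 6 = Suc (regs s 6) + length e" "regs s2 0 = (if Q e then 1 else regs s 0)"
    using k1 r1 by (auto intro: keeps_trans)
  obtain s' where s': "runs (While (Less 4 5) (Seq read_edge chk)) s2
        (length es * (cost chk + 10) + 1) s'" "\<forall>k. keeps k s0 s'"
      "regs s' 0 = (if \<exists>e\<in>set es. Q e then 1 else regs s2 0)"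
    using Cons.IH[of s2] Cons.prems(1) s2 st(3) by auto
  have "runs (Seq read_edge chk) s (9 + cost chk) s2"
  proof (rule runs_Seq)
    show "runs read_edge s 9 s1" by (rule runs_loop_freeI) (simp_all add: read_edge_def s1_def)
    show "runs chk s1 (cost chk) s2" using chk by (simp add: checks_def s2_def runs_loop_free)
  qed
  moreover have "holds (Less 4 5) s" using Cons.prems(4) regs by simp
  ultimately have "runs (While (Less 4 5) (Seq read_edge chk)) s
      (1 + (9 + cost chk) + (length es * (cost chk + 10) + 1)) s'"
    using s'(1) runs_WhileTrue by blast
  then show ?case
    using s'(2,3) s2(4) by (intro exI[of _ s']) (auto elim!: runs_mono)
qed

definition check_empty :: com where
  "check_empty = Cond (Equal 7 4) (Const 0 1) Skip"

text \<open>A singleton is turned into a pair by copying register 8 to 9, so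
  \<open>check_edge x x\<close> recognizes forbidden vertices. Pairs are compared in both
  orders.\<close>

definition check_edge :: "reg \<Rightarrow> reg \<Rightarrow> com" where
  "check_edge x y = Cond (Equal 7 4) Skip
     (Seq (Cond (Equal 7 1) (Add 9 8 4) Skip)
       (Cond (Equal 8 x) (Cond (Equal 9 y) (Const 0 1) Skip)
         (Cond (Equal 8 y) (Cond (Equal 9 x) (Const 0 1) Skip) Skip)))"

lemma short_list_cases:
  assumes "length e \<le> 2"
  obtains "e = []" | x where "e = [x]" | x y where "e = [x, y]"
  using assms by (cases e; cases "tl e") (auto simp: neq_Nil_conv)

lemma checks_empty:
  assumes "regs s0 4 = 0"
  shows "checks s0 check_empty (\<lambda>e. set e = {})"
  using assms by (auto simp: checks_def check_empty_def keeps_def)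

lemma checks_edge:
  assumes "regs s0 1 = 1" "regs s0 4 = 0" "10 \<le> x" "10 \<le> y"
  shows "checks s0 (check_edge x y) (\<lambda>e. set e = {regs s0 x, regs s0 y})"
proof -
  have "(\<forall>k. keeps k s (run (check_edge x y) s)) \<and> regs (run (check_edge x y) s) 5 = regs s 5 \<and>
        regs (run (check_edge x y) s) 6 = regs s 6 \<and>
        regs (run (check_edge x y) s) 0 = (if set e = {regs s0 x, regs s0 y} then 1 else regs s 0)"
    if k: "\<forall>k. keeps k s0 s" and e: "length e \<le> 2" "distinct e" "regs s 7 = length e"
      "\<forall>x. e = [x] \<longrightarrow> regs s 8 = x" "\<forall>x y. e = [x, y] \<longrightarrow> regs s 8 = x \<and> regs s 9 = y"
    for s e
  proof -
    have r: "regs s 1 = 1" "regs s 4 = 0"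
      using k assms by (simp_all add: keeps_def)
    have xy: "regs s x = regs s0 x" "regs s y = regs s0 y"
      using k[rule_format, of "Suc x"] k[rule_format, of "Suc y"] assms by (simp_all add: keeps_def)
    show ?thesis
      using e(1)
    proof (cases rule: short_list_cases)
      case 1
      then show ?thesis using e r by (simp add: check_edge_def keeps_def)
    next
      case 2
      then show ?thesis using e r xy assms(3,4)
        by (auto simp: check_edge_def keeps_def doubleton_eq_iff)
    next
      case 3
      then show ?thesis using e r xy assms(3,4)
        by (auto simp: check_edge_def keeps_def doubleton_eq_iff)
    qed
  qed
  then show ?thesis by (auto simp: checks_def) (simp_all add: check_edge_def)
qed

definition loaded :: "nat \<Rightarrow> nat list list \<Rightarrow> state \<Rightarrow> bool" where
  "loaded n es s \<longleftrightarrow> regs s 1 = 1 \<and> regs s 2 = n \<and> regs s 3 = length es \<and> regs s 4 = 0 \<and>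
     stored (mem s) 2 (edge_words es)"

lemma loaded_keeps: "loaded n es s \<Longrightarrow> keeps k s s' \<Longrightarrow> loaded n es s'"
  by (simp add: loaded_def keeps_def)

lemma runs_scan:
  assumes "loaded n es s" "\<forall>e\<in>set es. length e \<le> 2 \<and> distinct e" "checks s chk Q"
  shows "\<exists>s'. runs (scan chk) s (length es * (cost chk + 10) + 5) s' \<and>
    (\<forall>k. keeps k s s') \<and> regs s' 0 = of_bool (\<exists>e\<in>set es. Q e)"
proof -
  define s1 where "s1 = run (seqs [Const 0 0, Add 5 3 4, Const 6 2]) s"
  have s1: "\<forall>k. keeps k s s1" "regs s1 6 = 2" "regs s1 5 = length es" "regs s1 0 = 0"
    using assms(1) by (auto simp: s1_def keeps_def loaded_def)
  have "\<exists>s'. runs (While (Less 4 5) (Seq read_edge chk)) s1 (length es * (cost chk + 10) + 1) s' \<and>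
      (\<forall>k. keeps k s s') \<and> regs s' 0 = (if \<exists>e\<in>set es. Q e then 1 else regs s1 0)"
    using assms s1 by (intro scan_loop) (auto simp: loaded_def)
  then obtain s' where s': "runs (While (Less 4 5) (Seq read_edge chk)) s1 (length es * (cost chk + 10) + 1) s'"
      "\<forall>k. keeps k s s'" "regs s' 0 = (if \<exists>e\<in>set es. Q e then 1 else regs s1 0)" by blast
  have "runs (scan chk) s (1 + (1 + (1 + ((length es * (cost chk + 10) + 1) + 1)))) s'"
    unfolding scan_def seqs.simps
  proof (intro runs_Seq)
    show "runs (Const 0 0) s 1 (run (Const 0 0) s)" by (rule runs_loop_freeI) simp_all
    show "runs (Add 5 3 4) (run (Const 0 0) s) 1 (run (Add 5 3 4) (run (Const 0 0) s))"
      by (rule runs_loop_freeI) simp_all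
    show "runs (Const 6 2) (run (Add 5 3 4) (run (Const 0 0) s)) 1 s1"
      by (rule runs_loop_freeI) (simp_all add: s1_def)
    show "runs Skip s' 1 s'" by (rule runs_loop_freeI) simp_all
  qed (rule s')
  then have "runs (scan chk) s (length es * (cost chk + 10) + 5) s'"
    by (rule runs_mono) simp
  moreover have "regs s' 0 = of_bool (\<exists>e\<in>set es. Q e)" using s'(3) s1(4) by simp
  ultimately show ?thesis using s'(2) by blast
qed

section \<open>Loops over the vertices\<close>

definition quantify :: "nat \<Rightarrow> com \<Rightarrow> com \<Rightarrow> com" where
  "quantify d upd P = seqs [Const (acc d) 0, Const (var d) 0,
     While (Less (var d) 2) (Seq P (Seq upd (Add (var d) (var d) 1))), Add 0 (acc d) 4]"

text \<open>\<open>G i\<close> is the value accumulated over the vertices below \<open>i\<close>,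
  and \<open>g\<close> is one update. The induction is on the number \<open>j\<close> of vertices
  still to visit; the 2 counts the loop test and the increment.\<close>

lemma quantify_loop:
  assumes loaded: "loaded n es s0"
    and P: "\<And>s i. keeps (var d) s0 s \<Longrightarrow> i < n \<Longrightarrow> regs s (var d) = i \<Longrightarrow>
      \<exists>s'. runs P s T s' \<and> keeps (var (Suc d)) s s' \<and> regs s' 0 = of_bool (\<phi> i)"
    and upd: "loop_free upd" "\<And>s a b. regs s (acc d) = of_bool a \<Longrightarrow> regs s 0 = of_bool b \<Longrightarrow>
      regs s 1 = 1 \<Longrightarrow> regs s 4 = 0 \<Longrightarrow>
      run upd s = s\<lparr>regs := (regs s)(acc d := of_bool (g a b))\<rparr>"
    and G: "\<And>i. i < n \<Longrightarrow> G (Suc i) = g (G i) (\<phi> i)"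
  shows "keeps (var d) s0 s \<Longrightarrow> i \<le> n \<Longrightarrow> n - i = j \<Longrightarrow> regs s (var d) = i \<Longrightarrow>
    regs s (acc d) = of_bool (G i) \<Longrightarrow>
    \<exists>s'. runs (While (Less (var d) 2) (Seq P (Seq upd (Add (var d) (var d) 1)))) s
      (j * (T + cost upd + 2) + 1) s' \<and> keeps (var d) s0 s' \<and> regs s' (acc d) = of_bool (G n)"
proof (induction j arbitrary: s i)
  case 0
  have "regs s 2 = n" using loaded 0 by (simp add: loaded_def keeps_def)
  then have "\<not> holds (Less (var d) 2) s" using 0 by simp
  then have "runs (While (Less (var d) 2) (Seq P (Seq upd (Add (var d) (var d) 1)))) s 1 s"
    by (rule runs_WhileFalse)
  then show ?case using 0 by auto
next
  case (Suc j)
  have i: "i < n" using Suc.prems by simp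
  obtain s1 where s1: "runs P s T s1" "keeps (var (Suc d)) s s1" "regs s1 0 = of_bool (\<phi> i)"
    using P[of s i] Suc.prems i by blast
  have r1: "regs s1 (acc d) = of_bool (G i)" "regs s1 (var d) = i" "keeps (var d) s s1"
    using s1(2) Suc.prems by (simp_all add: keeps_def)
  then have k1: "keeps (var d) s0 s1" using Suc.prems(1) keeps_trans by blast
  then have c1: "regs s1 1 = 1" "regs s1 4 = 0" using loaded by (simp_all add: loaded_def keeps_def)
  define s2 where "s2 = run (Seq upd (Add (var d) (var d) 1)) s1"
  have s2: "s2 = s1\<lparr>regs := (regs s1)(acc d := of_bool (G (Suc i)), var d := Suc i)\<rparr>"
    using upd(2)[OF r1(1) s1(3) c1] c1 r1 G[OF i] by (simp add: s2_def)
  have k2: "keeps (var d) s0 s2" using k1 by (auto simp: s2 keeps_def)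
  have "\<exists>s'. runs (While (Less (var d) 2) (Seq P (Seq upd (Add (var d) (var d) 1)))) s2
      (j * (T + cost upd + 2) + 1) s' \<and> keeps (var d) s0 s' \<and> regs s' (acc d) = of_bool (G n)"
    using Suc.prems i k2 by (intro Suc.IH[of s2 "Suc i"]) (auto simp: s2)
  then obtain s' where s': "runs (While (Less (var d) 2) (Seq P (Seq upd (Add (var d) (var d) 1)))) s2
      (j * (T + cost upd + 2) + 1) s'" "keeps (var d) s0 s'" "regs s' (acc d) = of_bool (G n)" by blast
  have "runs (Seq P (Seq upd (Add (var d) (var d) 1))) s (T + (cost upd + 1)) s2"
    using s1(1) by (rule runs_Seq) (rule runs_loop_freeI, simp_all add: upd(1) s2_def)
  moreover have "holds (Less (var d) 2) s"
    using Suc.prems i loaded by (simp add: loaded_def keeps_def)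
  ultimately have "runs (While (Less (var d) 2) (Seq P (Seq upd (Add (var d) (var d) 1)))) s
      (1 + (T + (cost upd + 1)) + (j * (T + cost upd + 2) + 1)) s'"
    using s'(1) runs_WhileTrue by blast
  then show ?case
    using s'(2,3) by (intro exI[of _ s']) (auto elim!: runs_mono)
qed

lemma runs_quantify:
  assumes loaded: "loaded n es s"
    and P: "\<And>s1 i. keeps (var d) s s1 \<Longrightarrow> i < n \<Longrightarrow> regs s1 (var d) = i \<Longrightarrow>
      \<exists>s'. runs P s1 T s' \<and> keeps (var (Suc d)) s1 s' \<and> regs s' 0 = of_bool (\<phi> i)"
    and upd: "loop_free upd" "\<And>s a b. regs s (acc d) = of_bool a \<Longrightarrow> regs s 0 = of_bool b \<Longrightarrow>
      regs s 1 = 1 \<Longrightarrow> regs s 4 = 0 \<Longrightarrow>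
      run upd s = s\<lparr>regs := (regs s)(acc d := of_bool (g a b))\<rparr>"
    and G: "\<not> G 0" "\<And>i. i < n \<Longrightarrow> G (Suc i) = g (G i) (\<phi> i)"
  shows "\<exists>s'. runs (quantify d upd P) s (n * (T + cost upd + 2) + 5) s' \<and>
    keeps (var d) s s' \<and> regs s' 0 = of_bool (G n)"
proof -
  let ?W = "While (Less (var d) 2) (Seq P (Seq upd (Add (var d) (var d) 1)))"
  define s1 where "s1 = run (Seq (Const (acc d) 0) (Const (var d) 0)) s"
  have "keeps (var d) s s1" "regs s1 (var d) = 0" "regs s1 (acc d) = of_bool (G 0)"
    using G(1) by (auto simp: s1_def keeps_def)
  then have "\<exists>s2. runs ?W s1 (n * (T + cost upd + 2) + 1) s2 \<and> keeps (var d) s s2 \<and>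
      regs s2 (acc d) = of_bool (G n)"
  proof (intro quantify_loop[where \<phi> = \<phi> and g = g and i = 0 and T = T and n = n and es = es])
    show "\<exists>s'. runs P s1 T s' \<and> keeps (var (Suc d)) s1 s' \<and> regs s' 0 = of_bool (\<phi> i)"
      if "keeps (var d) s s1" "i < n" "regs s1 (var d) = i" for s1 i
      using that by (rule P)
    show "run upd s = s\<lparr>regs := (regs s)(acc d := of_bool (g a b))\<rparr>"
      if "regs s (acc d) = of_bool a" "regs s 0 = of_bool b" "regs s 1 = 1" "regs s 4 = 0" for s a b
      using that by (rule upd(2))
  qed (simp_all add: loaded upd(1) G(2))
  then obtain s2 where s2: "runs ?W s1 (n * (T + cost upd + 2) + 1) s2" "keeps (var d) s s2"
      "regs s2 (acc d) = of_bool (G n)" by blast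
  define s' where "s' = run (Add 0 (acc d) 4) s2"
  have "runs (quantify d upd P) s (1 + (1 + ((n * (T + cost upd + 2) + 1) + (1 + 1)))) s'"
    unfolding quantify_def seqs.simps
  proof (intro runs_Seq)
    show "runs (Const (acc d) 0) s 1 (run (Const (acc d) 0) s)" by (rule runs_loop_freeI) simp_all
    show "runs (Const (var d) 0) (run (Const (acc d) 0) s) 1 s1"
      by (rule runs_loop_freeI) (simp_all add: s1_def)
    show "runs (Add 0 (acc d) 4) s2 1 s'" by (rule runs_loop_freeI) (simp_all add: s'_def)
    show "runs Skip s' 1 s'" by (rule runs_loop_freeI) simp_all
  qed (rule s2)
  then have "runs (quantify d upd P) s (n * (T + cost upd + 2) + 5) s'"
    by (rule runs_mono) simp
  moreover have "regs s2 4 = 0" using s2(2) loaded by (simp add: keeps_def loaded_def)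
  then have "regs s' 0 = of_bool (G n)" "keeps (var d) s s'"
    using s2 by (auto simp: s'_def keeps_def)
  ultimately show ?thesis by blast
qed

section \<open>Formulas and their translation\<close>

datatype formula = Empty_Edge | Edge nat nat | Eq nat nat | Neg formula
  | Conj formula formula | Exi formula | Odd formula

text \<open>The quantifiers at depth \<open>d\<close> bind variable \<open>d\<close>.\<close>

fun sem :: "'a set \<Rightarrow> 'a set set \<Rightarrow> nat \<Rightarrow> (nat \<Rightarrow> 'a) \<Rightarrow> formula \<Rightarrow> bool" where
  "sem V E d \<sigma> Empty_Edge \<longleftrightarrow> {} \<in> E"
| "sem V E d \<sigma> (Edge x y) \<longleftrightarrow> {\<sigma> x, \<sigma> y} \<in> E"
| "sem V E d \<sigma> (Eq x y) \<longleftrightarrow> \<sigma> x = \<sigma> y"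
| "sem V E d \<sigma> (Neg \<phi>) \<longleftrightarrow> \<not> sem V E d \<sigma> \<phi>"
| "sem V E d \<sigma> (Conj \<phi> \<psi>) \<longleftrightarrow> sem V E d \<sigma> \<phi> \<and> sem V E d \<sigma> \<psi>"
| "sem V E d \<sigma> (Exi \<phi>) \<longleftrightarrow> (\<exists>v\<in>V. sem V E (Suc d) (\<sigma>(d := v)) \<phi>)"
| "sem V E d \<sigma> (Odd \<phi>) \<longleftrightarrow> odd (card {v\<in>V. sem V E (Suc d) (\<sigma>(d := v)) \<phi>})"

fun scoped :: "nat \<Rightarrow> formula \<Rightarrow> bool" where
  "scoped d Empty_Edge \<longleftrightarrow> True"
| "scoped d (Edge x y) \<longleftrightarrow> x < d \<and> y < d"
| "scoped d (Eq x y) \<longleftrightarrow> x < d \<and> y < d"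
| "scoped d (Neg \<phi>) \<longleftrightarrow> scoped d \<phi>"
| "scoped d (Conj \<phi> \<psi>) \<longleftrightarrow> scoped d \<phi> \<and> scoped d \<psi>"
| "scoped d (Exi \<phi>) \<longleftrightarrow> scoped (Suc d) \<phi>"
| "scoped d (Odd \<phi>) \<longleftrightarrow> scoped (Suc d) \<phi>"

text \<open>Binding by depth fixes the register of each variable in advance. In the
  \<open>Odd\<close> case, \<open>Equal (acc d) 0\<close> compares with register 0, the result of
  the body, so the update is exclusive or.\<close>

fun compile :: "nat \<Rightarrow> formula \<Rightarrow> com" where
  "compile d Empty_Edge = scan check_empty"
| "compile d (Edge x y) = scan (check_edge (var x) (var y))"
| "compile d (Eq x y) = Cond (Equal (var x) (var y)) (Const 0 1) (Const 0 0)"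
| "compile d (Neg \<phi>) = Seq (compile d \<phi>) (Cond (Equal 0 4) (Const 0 1) (Const 0 0))"
| "compile d (Conj \<phi> \<psi>) = Seq (compile d \<phi>) (Cond (Equal 0 4) Skip (compile d \<psi>))"
| "compile d (Exi \<phi>) =
     quantify d (Cond (Equal 0 4) Skip (Const (acc d) 1)) (compile (Suc d) \<phi>)"
| "compile d (Odd \<phi>) =
     quantify d (Cond (Equal (acc d) 0) (Const (acc d) 0) (Const (acc d) 1)) (compile (Suc d) \<phi>)"

text \<open>A scanning round takes 12 or 17 steps, rounded up to 20. The 4 per vertex is loop test,
  increment and a two-step update.\<close>

fun time_bound :: "formula \<Rightarrow> nat \<Rightarrow> nat" where
  "time_bound Empty_Edge S = S * 20 + 5"
| "time_bound (Edge x y) S = S * 20 + 5"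
| "time_bound (Eq x y) S = 2"
| "time_bound (Neg \<phi>) S = time_bound \<phi> S + 2"
| "time_bound (Conj \<phi> \<psi>) S = time_bound \<phi> S + (time_bound \<psi> S + 2)"
| "time_bound (Exi \<phi>) S = S * (time_bound \<phi> S + 4) + 5"
| "time_bound (Odd \<phi>) S = S * (time_bound \<phi> S + 4) + 5"

text \<open>The base \<open>Suc S\<close> is at least 1, so constants and lower powers are absorbed
  even for \<open>S = 0\<close>.\<close>

lemma time_bound_polynomial: "\<exists>c k. \<forall>S. time_bound \<phi> S \<le> c * Suc S ^ k"
proof (induction \<phi>)
  case (Eq x y)
  show ?case by (intro exI[of _ 2] exI[of _ 0]) simp
next
  case (Neg \<phi>)
  then obtain c k where "\<And>S. time_bound \<phi> S \<le> c * Suc S ^ k" by blast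
  moreover have "(1::nat) \<le> Suc S ^ k" for S by simp
  ultimately have "time_bound (Neg \<phi>) S \<le> (c + 2) * Suc S ^ k" for S
    unfolding time_bound.simps distrib_right by (metis add_mono mult.right_neutral mult_le_mono2)
  then show ?case by blast
next
  case (Conj \<phi> \<psi>)
  then obtain c k c' k' where *: "\<And>S. time_bound \<phi> S \<le> c * Suc S ^ k"
    "\<And>S. time_bound \<psi> S \<le> c' * Suc S ^ k'" by blast
  have "time_bound (Conj \<phi> \<psi>) S \<le> (c + c' + 2) * Suc S ^ (k + k')" for S
  proof -
    have "Suc S ^ k \<le> Suc S ^ (k + k')" "Suc S ^ k' \<le> Suc S ^ (k + k')"
      by (rule power_increasing; simp)+
    then have "time_bound \<phi> S \<le> c * Suc S ^ (k + k')" "time_bound \<psi> S \<le> c' * Suc S ^ (k + k')"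
      using *[of S] by (meson mult_le_mono2 order_trans)+
    moreover have "2 \<le> 2 * Suc S ^ (k + k')" by simp
    ultimately show ?thesis unfolding time_bound.simps distrib_right by linarith
  qed
  then show ?case by blast
next
  case (Exi \<phi>)
  then obtain c k where *: "\<And>S. time_bound \<phi> S \<le> c * Suc S ^ k" by blast
  \<comment> \<open>The 9 absorbs \<open>4 * S + 5\<close>.\<close>
  have "time_bound (Exi \<phi>) S \<le> (c + 9) * Suc S ^ Suc k" for S
  proof -
    have "S * time_bound \<phi> S \<le> Suc S * (c * Suc S ^ k)" by (intro mult_mono *) auto
    moreover have "Suc S \<le> Suc S ^ Suc k"
      using power_increasing[of 1 "Suc k" "Suc S"] by simp
    ultimately show ?thesis
      by (simp only: time_bound.simps distrib_right distrib_left power_Suc ac_simps)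
  qed
  then show ?case by blast
next
  case (Odd \<phi>)
  then obtain c k where *: "\<And>S. time_bound \<phi> S \<le> c * Suc S ^ k" by blast
  have "time_bound (Odd \<phi>) S \<le> (c + 9) * Suc S ^ Suc k" for S
  proof -
    have "S * time_bound \<phi> S \<le> Suc S * (c * Suc S ^ k)" by (intro mult_mono *) auto
    moreover have "Suc S \<le> Suc S ^ Suc k"
      using power_increasing[of 1 "Suc k" "Suc S"] by simp
    ultimately show ?thesis
      by (simp only: time_bound.simps distrib_right distrib_left power_Suc ac_simps)
  qed
  then show ?case by blast
qed (intro exI[of _ 20] exI[of _ 1]; simp)+

text \<open>The induction rests on \<open>keeps (var d)\<close>: after a subformula has been
  evaluated, the outer variables still hold the valuation.\<close>

lemma runs_compile:
  assumes es: "\<forall>e\<in>set es. length e \<le> 2 \<and> distinct e" and S: "n \<le> S" "length es \<le> S"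
  shows "loaded n es s \<Longrightarrow> \<forall>x<d. regs s (var x) = \<sigma> x \<Longrightarrow> scoped d \<phi> \<Longrightarrow>
    \<exists>s'. runs (compile d \<phi>) s (time_bound \<phi> S) s' \<and> keeps (var d) s s' \<and>
      regs s' 0 = of_bool (sem {..<n} (set ` set es) d \<sigma> \<phi>)"
proof (induction \<phi> arbitrary: d \<sigma> s)
  case Empty_Edge
  have "checks s check_empty (\<lambda>e. set e = {})"
    using Empty_Edge by (intro checks_empty) (simp add: loaded_def)
  then obtain s' where s': "runs (scan check_empty) s (length es * (cost check_empty + 10) + 5) s'"
    "\<forall>k. keeps k s s'" "regs s' 0 = of_bool (\<exists>e\<in>set es. set e = {})"
    using runs_scan[OF Empty_Edge(1) es] by blast
  have "length es * (cost check_empty + 10) \<le> S * 20"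
    using S(2) by (intro mult_mono) (auto simp: check_empty_def)
  then have "runs (scan check_empty) s (S * 20 + 5) s'" using s'(1) by (auto elim: runs_mono)
  then show ?case using s'(2,3) by (auto simp: image_iff)
next
  case (Edge x y)
  have "checks s (check_edge (var x) (var y)) (\<lambda>e. set e = {regs s (var x), regs s (var y)})"
    using Edge by (intro checks_edge) (simp_all add: loaded_def)
  then obtain s' where s': "runs (scan (check_edge (var x) (var y))) s
      (length es * (cost (check_edge (var x) (var y)) + 10) + 5) s'"
    "\<forall>k. keeps k s s'" "regs s' 0 = of_bool (\<exists>e\<in>set es. set e = {regs s (var x), regs s (var y)})"
    using runs_scan[OF Edge(1) es] by blast
  have "length es * (cost (check_edge (var x) (var y)) + 10) \<le> S * 20"
    using S(2) by (intro mult_mono) (auto simp: check_edge_def)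
  then have "runs (scan (check_edge (var x) (var y))) s (S * 20 + 5) s'"
    using s'(1) by (auto elim: runs_mono)
  moreover have "regs s (var x) = \<sigma> x" "regs s (var y) = \<sigma> y" using Edge by simp_all
  moreover have "(\<exists>e\<in>set es. set e = A) \<longleftrightarrow> A \<in> set ` set es" for A by blast
  ultimately show ?case using s'(2,3) by (intro exI[of _ s']) simp
next
  case (Eq x y)
  let ?P = "Cond (Equal (var x) (var y)) (Const 0 1) (Const 0 0)"
  have "runs ?P s 2 (run ?P s)" by (rule runs_loop_freeI) simp_all
  then show ?case using Eq by (intro exI[of _ "run ?P s"]) (auto simp: keeps_def)
next
  case (Neg \<phi>)
  let ?P = "Cond (Equal 0 4) (Const 0 1) (Const 0 0)"
  obtain s1 where s1: "runs (compile d \<phi>) s (time_bound \<phi> S) s1" "keeps (var d) s s1"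
      "regs s1 0 = of_bool (sem {..<n} (set ` set es) d \<sigma> \<phi>)"
    using Neg by (metis scoped.simps(4))
  have "regs s1 4 = 0" using loaded_keeps[OF Neg.prems(1) s1(2)] by (simp add: loaded_def)
  moreover have "runs ?P s1 2 (run ?P s1)" by (rule runs_loop_freeI) simp_all
  then have "runs (compile d (Neg \<phi>)) s (time_bound \<phi> S + 2) (run ?P s1)"
    unfolding compile.simps using s1(1) by (intro runs_Seq)
  ultimately show ?case
    using s1(2,3) by (intro exI[of _ "run ?P s1"]) (auto simp: keeps_def)
next
  case (Conj \<phi> \<psi>)
  obtain s1 where s1: "runs (compile d \<phi>) s (time_bound \<phi> S) s1" "keeps (var d) s s1"
      "regs s1 0 = of_bool (sem {..<n} (set ` set es) d \<sigma> \<phi>)"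
    using Conj.IH(1)[of s d \<sigma>] Conj.prems by auto
  have l1: "loaded n es s1" using loaded_keeps[OF Conj.prems(1) s1(2)] .
  then have zero: "regs s1 4 = 0" by (simp add: loaded_def)
  let ?P = "Cond (Equal 0 4) Skip (compile d \<psi>)"
  show ?case
  proof (cases "sem {..<n} (set ` set es) d \<sigma> \<phi>")
    case True
    have "\<forall>x<d. regs s1 (var x) = \<sigma> x" using s1(2) Conj.prems(2) by (simp add: keeps_def)
    then obtain s2 where s2: "runs (compile d \<psi>) s1 (time_bound \<psi> S) s2" "keeps (var d) s1 s2"
        "regs s2 0 = of_bool (sem {..<n} (set ` set es) d \<sigma> \<psi>)"
      using Conj.IH(2)[of s1 d \<sigma>] Conj.prems l1 by auto
    have "runs ?P s1 (1 + time_bound \<psi> S) s2"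
      using s2(1) True s1(3) zero by (intro runs_CondFalse) auto
    then have "runs (compile d (Conj \<phi> \<psi>)) s (time_bound \<phi> S + (1 + time_bound \<psi> S)) s2"
      unfolding compile.simps using s1(1) by (intro runs_Seq)
    then show ?thesis
      using True s2(3) keeps_trans[OF s1(2) s2(2)]
      by (intro exI[of _ s2]) (auto elim!: runs_mono)
  next
    case False
    have "runs ?P s1 (1 + 1) s1"
      using False s1(3) zero runs_loop_free[of Skip s1] by (intro runs_CondTrue) auto
    then have "runs (compile d (Conj \<phi> \<psi>)) s (time_bound \<phi> S + (1 + 1)) s1"
      unfolding compile.simps using s1(1) by (intro runs_Seq)
    then show ?thesis
      using False s1(2,3) by (intro exI[of _ s1]) (auto elim!: runs_mono)
  qed
next
  case (Exi \<phi>)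
  let ?u = "Cond (Equal 0 4) Skip (Const (acc d) 1)"
  let ?\<phi> = "\<lambda>i. sem {..<n} (set ` set es) (Suc d) (\<sigma>(d := i)) \<phi>"
  have "\<exists>s'. runs (quantify d ?u (compile (Suc d) \<phi>)) s (n * (time_bound \<phi> S + cost ?u + 2) + 5) s' \<and>
    keeps (var d) s s' \<and> regs s' 0 = of_bool (\<exists>k<n. ?\<phi> k)"
  proof (rule runs_quantify[where \<phi> = ?\<phi> and g = "\<lambda>a b. a \<or> b"
        and G = "\<lambda>i. \<exists>k<i. ?\<phi> k", OF Exi.prems(1)])
    show "\<exists>s'. runs (compile (Suc d) \<phi>) s1 (time_bound \<phi> S) s' \<and> keeps (var (Suc d)) s1 s' \<and>
        regs s' 0 = of_bool (?\<phi> i)"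
      if "keeps (var d) s s1" "i < n" "regs s1 (var d) = i" for s1 i
      using that Exi.prems loaded_keeps[OF Exi.prems(1) that(1)]
      by (intro Exi.IH) (auto simp: keeps_def less_Suc_eq)
    show "run ?u s = s\<lparr>regs := (regs s)(acc d := of_bool (a \<or> b))\<rparr>"
      if "regs s (acc d) = of_bool a" "regs s 0 = of_bool b" "regs s 1 = 1" "regs s 4 = 0" for s a b
      using that by (cases s; cases a; cases b; simp add: fun_upd_idem)
  qed (auto simp: less_Suc_eq)
  then obtain s' where s': "runs (quantify d ?u (compile (Suc d) \<phi>)) s
      (n * (time_bound \<phi> S + cost ?u + 2) + 5) s'" "keeps (var d) s s'"
      "regs s' 0 = of_bool (\<exists>k<n. ?\<phi> k)" by blast
  have "n * (time_bound \<phi> S + cost ?u + 2) + 5 \<le> time_bound (Exi \<phi>) S"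
    unfolding time_bound.simps using S(1) by (intro add_le_mono1 mult_le_mono) simp_all
  with s'(1) have "runs (compile d (Exi \<phi>)) s (time_bound (Exi \<phi>) S) s'"
    unfolding compile.simps by (rule runs_mono)
  moreover have "(\<exists>k<n. ?\<phi> k) \<longleftrightarrow> sem {..<n} (set ` set es) d \<sigma> (Exi \<phi>)" by auto
  ultimately show ?case using s'(2,3) by (intro exI[of _ s']) simp
next
  case (Odd \<phi>)
  let ?u = "Cond (Equal (acc d) 0) (Const (acc d) 0) (Const (acc d) 1)"
  let ?\<phi> = "\<lambda>i. sem {..<n} (set ` set es) (Suc d) (\<sigma>(d := i)) \<phi>"
  have "\<exists>s'. runs (quantify d ?u (compile (Suc d) \<phi>)) s (n * (time_bound \<phi> S + cost ?u + 2) + 5) s' \<and>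
    keeps (var d) s s' \<and> regs s' 0 = of_bool (odd (card {k\<in>{..<n}. ?\<phi> k}))"
  proof (rule runs_quantify[where \<phi> = ?\<phi> and g = "\<lambda>a b. a \<noteq> b"
        and G = "\<lambda>i. odd (card {k\<in>{..<i}. ?\<phi> k})", OF Odd.prems(1)])
    show "\<exists>s'. runs (compile (Suc d) \<phi>) s1 (time_bound \<phi> S) s' \<and> keeps (var (Suc d)) s1 s' \<and>
        regs s' 0 = of_bool (?\<phi> i)"
      if "keeps (var d) s s1" "i < n" "regs s1 (var d) = i" for s1 i
      using that Odd.prems loaded_keeps[OF Odd.prems(1) that(1)]
      by (intro Odd.IH) (auto simp: keeps_def less_Suc_eq)
    show "run ?u s = s\<lparr>regs := (regs s)(acc d := of_bool (a \<noteq> b))\<rparr>"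
      if "regs s (acc d) = of_bool a" "regs s 0 = of_bool b" "regs s 1 = 1" "regs s 4 = 0" for s a b
      using that by (cases s; cases a; cases b; simp add: fun_upd_idem)
    show "odd (card {k\<in>{..<Suc i}. ?\<phi> k}) = (odd (card {k\<in>{..<i}. ?\<phi> k}) \<noteq> ?\<phi> i)" for i
    proof -
      have "{k\<in>{..<Suc i}. ?\<phi> k} = (if ?\<phi> i then insert i {k\<in>{..<i}. ?\<phi> k} else {k\<in>{..<i}. ?\<phi> k})"
        by (auto simp: less_Suc_eq)
      then show ?thesis by (simp add: card_insert_if)
    qed
  qed auto
  then obtain s' where s': "runs (quantify d ?u (compile (Suc d) \<phi>)) s
      (n * (time_bound \<phi> S + cost ?u + 2) + 5) s'" "keeps (var d) s s'"
      "regs s' 0 = of_bool (odd (card {k\<in>{..<n}. ?\<phi> k}))" by blast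
  have "n * (time_bound \<phi> S + cost ?u + 2) + 5 \<le> time_bound (Odd \<phi>) S"
    unfolding time_bound.simps using S(1) by (intro add_le_mono1 mult_le_mono) simp_all
  with s'(1) have "runs (compile d (Odd \<phi>)) s (time_bound (Odd \<phi>) S) s'"
    unfolding compile.simps by (rule runs_mono)
  then show ?case using s'(2,3) by (intro exI[of _ s']) simp
qed

lemma sem_image:
  assumes "inj_on num V" "E \<subseteq> Pow V"
  shows "scoped d \<phi> \<Longrightarrow> \<forall>x<d. \<sigma> x \<in> V \<and> \<tau> x = num (\<sigma> x) \<Longrightarrow>
    sem (num ` V) ((`) num ` E) d \<tau> \<phi> \<longleftrightarrow> sem V E d \<sigma> \<phi>"
proof (induction \<phi> arbitrary: d \<sigma> \<tau>)
  case (Edge x y)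
  have "num ` e = num ` {\<sigma> x, \<sigma> y} \<longleftrightarrow> e = {\<sigma> x, \<sigma> y}" if "e \<in> E" for e
    using assms that Edge by (intro inj_on_image_eq_iff) auto
  then show ?case using Edge by (auto simp: image_iff)
next
  case (Eq x y)
  then show ?case using assms(1) by (auto simp: inj_on_eq_iff)
next
  case (Conj \<phi> \<psi>)
  then show ?case by (metis scoped.simps(5) sem.simps(5))
next
  case (Exi \<phi>)
  have "sem (num ` V) ((`) num ` E) (Suc d) (\<tau>(d := num v)) \<phi> \<longleftrightarrow>
      sem V E (Suc d) (\<sigma>(d := v)) \<phi>" if "v \<in> V" for v
    using Exi.prems that by (intro Exi.IH) (auto simp: less_Suc_eq)
  then show ?case by simp
next
  case (Odd \<phi>)
  have "sem (num ` V) ((`) num ` E) (Suc d) (\<tau>(d := num v)) \<phi> \<longleftrightarrow>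
      sem V E (Suc d) (\<sigma>(d := v)) \<phi>" if "v \<in> V" for v
    using Odd.prems that by (intro Odd.IH) (auto simp: less_Suc_eq)
  then have "{v \<in> num ` V. sem (num ` V) ((`) num ` E) (Suc d) (\<tau>(d := v)) \<phi>} =
      num ` {v\<in>V. sem V E (Suc d) (\<sigma>(d := v)) \<phi>}" by auto
  moreover have "inj_on num {v\<in>V. sem V E (Suc d) (\<sigma>(d := v)) \<phi>}"
    using assms(1) by (rule inj_on_subset) auto
  ultimately show ?case by (simp add: card_image)
qed auto


section \<open>Computing the outcome\<close>

definition Disj :: "formula \<Rightarrow> formula \<Rightarrow> formula" where
  "Disj \<phi> \<psi> = Neg (Conj (Neg \<phi>) (Neg \<psi>))"

definition All :: "formula \<Rightarrow> formula" where
  "All \<phi> = Neg (Exi (Neg \<phi>))"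

lemma sem_Disj [simp]: "sem V E d \<sigma> (Disj \<phi> \<psi>) \<longleftrightarrow> sem V E d \<sigma> \<phi> \<or> sem V E d \<sigma> \<psi>"
  by (simp add: Disj_def)

lemma sem_All [simp]: "sem V E d \<sigma> (All \<phi>) \<longleftrightarrow> (\<forall>v\<in>V. sem V E (Suc d) (\<sigma>(d := v)) \<phi>)"
  by (simp add: All_def)

lemma scoped_Disj [simp]: "scoped d (Disj \<phi> \<psi>) \<longleftrightarrow> scoped d \<phi> \<and> scoped d \<psi>"
  by (simp add: Disj_def)

lemma scoped_All [simp]: "scoped d (All \<phi>) \<longleftrightarrow> scoped (Suc d) \<phi>"
  by (simp add: All_def)

text \<open>\<open>Eq x x\<close> stands for truth, which has no constructor.\<close>

fun Not_In :: "nat \<Rightarrow> nat list \<Rightarrow> formula" where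
  "Not_In x [] = Eq x x"
| "Not_In x (u # us) = Conj (Neg (Eq x u)) (Not_In x us)"

lemma sem_Not_In [simp]: "sem V E d \<sigma> (Not_In x us) \<longleftrightarrow> \<sigma> x \<notin> \<sigma> ` set us"
  by (induction us) auto

lemma scoped_Not_In [simp]: "scoped d (Not_In x us) \<longleftrightarrow> x < d \<and> (\<forall>u\<in>set us. u < d)"
  by (induction us) auto

definition Adj :: "nat \<Rightarrow> nat \<Rightarrow> formula" where
  "Adj x y = Conj (Neg (Eq x y)) (Edge x y)"

lemma sem_Adj [simp]: "sem V E d \<sigma> (Adj x y) \<longleftrightarrow> adj E (\<sigma> x) (\<sigma> y)"
  by (simp add: Adj_def adj_def)

lemma scoped_Adj [simp]: "scoped d (Adj x y) \<longleftrightarrow> x < d \<and> y < d"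
  by (auto simp: Adj_def)

text \<open>In the following formulas \<open>us\<close> lists the variables whose values are deleted from the
  graph; \<open>d\<close> is the depth at which the formula is used.\<close>

definition Matching :: "nat \<Rightarrow> nat list \<Rightarrow> formula" where
  "Matching d us = Neg (Exi (Exi (Exi (Conj (Not_In d us) (Conj (Not_In (Suc d) us)
     (Conj (Not_In (Suc (Suc d)) us) (Conj (Adj d (Suc d)) (Conj (Adj d (Suc (Suc d)))
       (Neg (Eq (Suc d) (Suc (Suc d))))))))))))"

text \<open>\<open>almost_matching\<close> admits a \<open>u\<close> outside the vertex set, whereas
  \<open>Exi\<close> does not; the first disjunct covers this, notably when there are no
  vertices.\<close>

definition Almost_Matching :: "nat \<Rightarrow> nat list \<Rightarrow> formula" where
  "Almost_Matching d us = Disj (Matching d us) (Exi (Matching (Suc d) (d # us)))"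

definition Odd_Core :: "nat \<Rightarrow> nat list \<Rightarrow> formula" where
  "Odd_Core d us = Odd (Conj (Not_In d us) (Exi (Conj (Not_In (Suc d) us) (Adj d (Suc d)))))"

definition Avoidable :: formula where
  "Avoidable = Disj (Almost_Matching 0 [])
     (Conj (Odd_Core 0 []) (All (Disj (Odd_Core 1 [0]) (Almost_Matching 1 [0]))))"

definition No_Loop :: formula where
  "No_Loop = Neg (Exi (Edge 0 0))"

definition Last_Win :: formula where
  "Last_Win = Conj (Neg Empty_Edge) (Conj No_Loop (Matching 0 []))"

definition Second_To_Last_Win :: formula where
  "Second_To_Last_Win = Conj (Neg Empty_Edge) (Disj (Conj No_Loop Avoidable)
     (Exi (Conj (Edge 0 0)
       (Conj (Neg (Exi (Conj (Edge 1 1) (Neg (Eq 0 1))))) (Matching 1 [0])))))"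

section \<open>Meaning of the formulas\<close>

lemma image_fun_upd:
  fixes x :: nat
  assumes "\<forall>u\<in>set us. u < x"
  shows "(\<sigma>(x := v)) ` set us = \<sigma> ` set us"
  using assms by (intro image_cong) auto

lemma sem_Matching:
  assumes "\<forall>u\<in>set us. u < d"
  shows "sem V E d \<sigma> (Matching d us) \<longleftrightarrow> matching E (V - \<sigma> ` set us)"
proof -
  have "\<forall>u\<in>set us. u < Suc d" "\<forall>u\<in>set us. u < Suc (Suc d)"
    using assms by (auto intro: less_SucI)
  then have "sem V E d \<sigma> (Matching d us) \<longleftrightarrow> \<not> (\<exists>x\<in>V. \<exists>y\<in>V. \<exists>z\<in>V.
      x \<notin> \<sigma> ` set us \<and> y \<notin> \<sigma> ` set us \<and> z \<notin> \<sigma> ` set us \<and> adj E x y \<and> adj E x z \<and> y \<noteq> z)"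
    using assms by (simp add: Matching_def image_fun_upd cong del: image_cong_simp)
  then show ?thesis unfolding matching_def by fast
qed

lemma sem_Almost_Matching:
  assumes "\<forall>u\<in>set us. u < d"
  shows "sem V E d \<sigma> (Almost_Matching d us) \<longleftrightarrow> almost_matching E (V - \<sigma> ` set us)"
proof -
  let ?F = "V - \<sigma> ` set us"
  have "sem V E (Suc d) (\<sigma>(d := u)) (Matching (Suc d) (d # us)) \<longleftrightarrow> matching E (?F - {u})" for u
  proof -
    have "\<forall>x\<in>set (d # us). x < Suc d" using assms by (auto intro: less_SucI)
    moreover have "V - (\<sigma>(d := u)) ` set (d # us) = ?F - {u}"
      unfolding list.set image_insert image_fun_upd[OF assms] by auto
    ultimately show ?thesis by (simp only: sem_Matching)
  qed
  then have "sem V E d \<sigma> (Almost_Matching d us) \<longleftrightarrow>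
      matching E ?F \<or> (\<exists>u\<in>V. matching E (?F - {u}))"
    unfolding Almost_Matching_def sem_Disj sem.simps sem_Matching[OF assms] by simp
  also have "\<dots> \<longleftrightarrow> (\<exists>u. matching E (?F - {u}))"
  proof
    assume "\<exists>u. matching E (?F - {u})"
    then obtain u where "matching E (?F - {u})" by blast
    then show "matching E ?F \<or> (\<exists>u\<in>V. matching E (?F - {u}))"
      by (cases "u \<in> V") auto
  next
    assume "matching E ?F \<or> (\<exists>u\<in>V. matching E (?F - {u}))"
    then show "\<exists>u. matching E (?F - {u})"
      using matching_mono[of E ?F "?F - {u}" for u] by blast
  qed
  finally show ?thesis by (simp add: almost_matching_def)
qed

lemma sem_Odd_Core:
  assumes "\<forall>u\<in>set us. u < d"
  shows "sem V E d \<sigma> (Odd_Core d us) \<longleftrightarrow> odd (card (core E (V - \<sigma> ` set us)))"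
proof -
  have "core E (V - \<sigma> ` set us) = {v\<in>V. sem V E (Suc d) (\<sigma>(d := v))
      (Conj (Not_In d us) (Exi (Conj (Not_In (Suc d) us) (Adj d (Suc d)))))}"
  proof -
    have "\<forall>u\<in>set us. u < Suc d" using assms by (auto intro: less_SucI)
    then have "sem V E (Suc d) (\<sigma>(d := v))
        (Conj (Not_In d us) (Exi (Conj (Not_In (Suc d) us) (Adj d (Suc d))))) \<longleftrightarrow>
        v \<notin> \<sigma> ` set us \<and> (\<exists>y\<in>V. y \<notin> \<sigma> ` set us \<and> adj E v y)" for v
      using assms by (simp add: image_fun_upd cong del: image_cong_simp)
    then show ?thesis unfolding core_def by blast
  qed
  then show ?thesis by (simp only: Odd_Core_def sem.simps(7))
qed

lemma sem_Avoidable: "sem V E 0 \<sigma> Avoidable \<longleftrightarrow> avoidable E V"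
proof -
  have "sem V E 0 \<sigma> Avoidable \<longleftrightarrow> almost_matching E V \<or> odd (card (core E V)) \<and>
      (\<forall>v\<in>V. even (card (core E (V - {v}))) \<longrightarrow> almost_matching E (V - {v}))"
    by (auto simp: Avoidable_def sem_Almost_Matching sem_Odd_Core)
  \<comment> \<open>Deleting a vertex outside \<open>V\<close> leaves the core odd, so the condition
    is vacuous there and may be quantified over \<open>V\<close>.\<close>
  moreover have "V - {v} = V" if "v \<notin> V" for v using that by blast
  ultimately show ?thesis unfolding avoidable_def by metis
qed

lemma sem_Last_Win: "sem V E 0 \<sigma> Last_Win \<longleftrightarrow> last_win V E"
  by (auto simp: Last_Win_def No_Loop_def last_win_def loops_def sem_Matching)

lemma sem_Second_To_Last_Win: "sem V E 0 \<sigma> Second_To_Last_Win \<longleftrightarrow> second_to_last_win V E"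
proof -
  have "loops V E = {v} \<longleftrightarrow> v \<in> V \<and> {v} \<in> E \<and> \<not> (\<exists>w\<in>V. {w} \<in> E \<and> v \<noteq> w)" for v
    unfolding loops_def set_eq_iff mem_Collect_eq singleton_iff by metis
  then have "(\<exists>v\<in>V. {v} \<in> E \<and> \<not> (\<exists>w\<in>V. {w} \<in> E \<and> v \<noteq> w) \<and> matching E (V - {v})) \<longleftrightarrow>
      (\<exists>v. loops V E = {v} \<and> matching E (V - {v}))"
    by auto
  also have "\<dots> \<longleftrightarrow> card (loops V E) = 1 \<and> matching E (V - loops V E)"
    by (auto simp: card_1_singleton_iff)
  finally have *: "(\<exists>v\<in>V. {v} \<in> E \<and> \<not> (\<exists>w\<in>V. {w} \<in> E \<and> v \<noteq> w) \<and> matching E (V - {v})) \<longleftrightarrow>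
      card (loops V E) = 1 \<and> matching E (V - loops V E)" .
  have "sem V E 0 \<sigma> Second_To_Last_Win \<longleftrightarrow> {} \<notin> E \<and> (\<not> (\<exists>v\<in>V. {v} \<in> E) \<and> avoidable E V \<or>
      (\<exists>v\<in>V. {v} \<in> E \<and> \<not> (\<exists>w\<in>V. {w} \<in> E \<and> v \<noteq> w) \<and> matching E (V - {v})))"
    by (simp add: Second_To_Last_Win_def No_Loop_def sem_Avoidable sem_Matching)
  moreover have "\<not> (\<exists>v\<in>V. {v} \<in> E) \<longleftrightarrow> loops V E = {}" by (auto simp: loops_def)
  ultimately show ?thesis unfolding * second_to_last_win_def by simp
qed

lemma scoped_win: "scoped 0 Last_Win" "scoped 0 Second_To_Last_Win"
  by (auto simp: Last_Win_def Second_To_Last_Win_def No_Loop_def Avoidable_def Matching_def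
      Almost_Matching_def Odd_Core_def)

section \<open>The program and its running time\<close>

text \<open>Registers start at 0, so \<open>Load 2 4\<close> reads the vertex count at address 0;
  register 1, set to 1, is then the address of the edge count.\<close>

definition outcome_program :: com where
  "outcome_program = Seq (Seq (Const 1 1) (Seq (Load 2 4) (Load 3 1)))
     (Seq (compile 0 Second_To_Last_Win)
       (Cond (Equal 0 4) (Const 0 2)
         (Seq (compile 0 Last_Win) (Cond (Equal 0 4) (Const 0 1) (Const 0 0)))))"

lemma outcome_program_correct:
  assumes H: "hypergraph H" "rank_le 2 H" and w: "encodes w H"
  defines "r \<equiv> if second_to_last_win (verts H) (edges H)
     then if last_win (verts H) (edges H) then Outcome_A else Outcome_SL else Outcome_E"
    and "S \<equiv> hypergraph_size H"
  shows "computes_within outcome_program w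
    (time_bound Second_To_Last_Win S + time_bound Last_Win S + 6) (outcome_code r)"
proof -
  obtain num es where num: "bij_betw num (verts H) {..<card (verts H)}"
    and es: "\<forall>e\<in>set es. distinct e" "distinct (map set es)"
      "set ` set es = (`) num ` edges H"
    and w_eq: "w = card (verts H) # length es # edge_words es"
    using w unfolding encodes_def edge_words_def by auto
  define n where "n = card (verts H)"
  have fin: "finite (edges H)" using H(1) by (auto simp: hypergraph_def intro: finite_subset)
  have short: "length e \<le> 2" if "e \<in> set es" for e
  proof -
    have "set e \<in> (`) num ` edges H" unfolding es(3)[symmetric] using that by (rule imageI)
    then obtain f where f: "f \<in> edges H" "set e = num ` f" by (rule imageE) simp
    have "finite f" using f(1) H(1) by (auto simp: hypergraph_def intro: finite_subset)
    then have "card (set e) \<le> card f" unfolding f(2) by (rule card_image_le)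
    also have "\<dots> \<le> 2" using f(1) H(2) by (simp add: rank_le_def)
    finally show ?thesis using es(1) that by (simp add: distinct_card)
  qed
  have "length es = card (set ` set es)"
    using distinct_card[OF es(2)] by simp
  also have "\<dots> \<le> card (edges H)" unfolding es(3) using fin by (rule card_image_le)
  finally have S: "n \<le> S" "length es \<le> S"
    by (simp_all add: S_def n_def hypergraph_size_def)
  have E: "{..<n} = num ` verts H" using num by (simp add: bij_betw_def n_def)
  have sem: "sem {..<n} (set ` set es) 0 \<sigma> \<phi> \<longleftrightarrow> sem (verts H) (edges H) 0 \<tau> \<phi>"
    if "scoped 0 \<phi>" for \<phi> \<sigma> \<tau>
    unfolding E es(3) using num H(1) that
    by (intro sem_image) (auto simp: bij_betw_def hypergraph_def)
  have run: "\<exists>s'. runs (compile 0 \<phi>) s (time_bound \<phi> S) s' \<and> loaded n es s' \<and>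
      regs s' 0 = of_bool (sem (verts H) (edges H) 0 \<tau> \<phi>)"
    if "loaded n es s" "scoped 0 \<phi>" for s \<phi> and \<tau> :: "nat \<Rightarrow> 'a"
  proof -
    \<comment> \<open>The formula is closed, so an arbitrary valuation serves.\<close>
    have "\<exists>s'. runs (compile 0 \<phi>) s (time_bound \<phi> S) s' \<and> keeps (var 0) s s' \<and>
        regs s' 0 = of_bool (sem {..<n} (set ` set es) 0 undefined \<phi>)"
      using es(1) short S that by (intro runs_compile) auto
    then obtain s' where s': "runs (compile 0 \<phi>) s (time_bound \<phi> S) s'" "keeps (var 0) s s'"
        "regs s' 0 = of_bool (sem {..<n} (set ` set es) 0 undefined \<phi>)" by blast
    show ?thesis
      using s'(1,3) loaded_keeps[OF that(1) s'(2)] sem[OF that(2), of undefined \<tau>]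
      by (intro exI[of _ s']) simp
  qed
  define s0 where "s0 = run (Seq (Const 1 1) (Seq (Load 2 4) (Load 3 1))) (initial_state w)"
  have "stored (mem (initial_state w)) 0 w" by (simp add: stored_def initial_state_def)
  then have "mem (initial_state w) 0 = n" "mem (initial_state w) 1 = length es"
    "stored (mem (initial_state w)) 2 (edge_words es)"
    unfolding w_eq n_def by (simp_all add: stored_Cons numeral_2_eq_2)
  then have l0: "loaded n es s0"
    by (simp add: s0_def loaded_def) (simp_all add: initial_state_def)
  have r0: "runs (Seq (Const 1 1) (Seq (Load 2 4) (Load 3 1))) (initial_state w) 3 s0"
    by (rule runs_loop_freeI) (simp_all add: s0_def)
  obtain s1 where s1: "runs (compile 0 Second_To_Last_Win) s0 (time_bound Second_To_Last_Win S) s1"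
      "loaded n es s1" "regs s1 0 = of_bool (second_to_last_win (verts H) (edges H))"
    using run[OF l0 scoped_win(2)] unfolding sem_Second_To_Last_Win by blast
  obtain s2 where s2: "runs (compile 0 Last_Win) s1 (time_bound Last_Win S) s2"
      "loaded n es s2" "regs s2 0 = of_bool (last_win (verts H) (edges H))"
    using run[OF s1(2) scoped_win(1)] unfolding sem_Last_Win by blast
  let ?L = "Cond (Equal 0 4) (Const 0 1) (Const 0 0)"
  have zero: "regs s1 4 = 0" "regs s2 4 = 0"
    using s1(2) s2(2) by (simp_all add: loaded_def)
  have "\<exists>s'. runs (Cond (Equal 0 4) (Const 0 2) (Seq (compile 0 Last_Win) ?L)) s1
      (1 + (time_bound Last_Win S + 2)) s' \<and> regs s' 0 = outcome_code r"
  proof (cases "second_to_last_win (verts H) (edges H)")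
    case True
    have "runs ?L s2 2 (run ?L s2)" by (rule runs_loop_freeI) simp_all
    then have "runs (Seq (compile 0 Last_Win) ?L) s1 (time_bound Last_Win S + 2) (run ?L s2)"
      using s2(1) by (intro runs_Seq)
    then have "runs (Cond (Equal 0 4) (Const 0 2) (Seq (compile 0 Last_Win) ?L)) s1
      (1 + (time_bound Last_Win S + 2)) (run ?L s2)"
      using True s1(3) zero by (intro runs_CondFalse) auto
    moreover have "regs (run ?L s2) 0 = outcome_code r"
      using True s2(3) zero by (auto simp: r_def)
    ultimately show ?thesis by blast
  next
    case False
    have "runs (Const 0 2) s1 1 (run (Const 0 2) s1)" by (rule runs_loop_freeI) simp_all
    then have "runs (Const 0 2) s1 (time_bound Last_Win S + 2) (run (Const 0 2) s1)"
      by (rule runs_mono) simp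
    then have "runs (Cond (Equal 0 4) (Const 0 2) (Seq (compile 0 Last_Win) ?L)) s1
      (1 + (time_bound Last_Win S + 2)) (run (Const 0 2) s1)"
      using False s1(3) zero by (intro runs_CondTrue) auto
    moreover have "regs (run (Const 0 2) s1) 0 = outcome_code r"
      using False by (simp add: r_def)
    ultimately show ?thesis by blast
  qed
  then obtain s' where s': "runs (Cond (Equal 0 4) (Const 0 2) (Seq (compile 0 Last_Win) ?L)) s1
      (1 + (time_bound Last_Win S + 2)) s'" "regs s' 0 = outcome_code r" by blast
  have "runs outcome_program (initial_state w)
      (3 + (time_bound Second_To_Last_Win S + (1 + (time_bound Last_Win S + 2)))) s'"
    unfolding outcome_program_def by (intro runs_Seq) (fact r0 s1(1) s'(1))+
  then have "runs outcome_program (initial_state w)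
      (time_bound Second_To_Last_Win S + time_bound Last_Win S + 6) s'"
    by (rule runs_mono) simp
  then show ?thesis using s'(2) unfolding computes_within_def runs_def by blast
qed

text \<open>Converts the bound to the shape \<open>c * S ^ k + c\<close>; the summand 1 accounts for
  \<open>S = 0\<close>.\<close>

lemma Suc_power_le: "Suc S ^ k \<le> 2 ^ k * S ^ k + 1"
proof (cases "S = 0")
  case False
  then have "Suc S ^ k \<le> (2 * S) ^ k" by (intro power_mono) auto
  then show ?thesis by (simp add: power_mult_distrib)
qed simp

theorem corollary3p3:
  shows "\<exists>(P :: com) (c :: nat) (k :: nat).
    \<forall>(H :: 'a hypergraph) (w :: nat list).
      hypergraph H \<and> rank_le 2 H \<and> encodes w H \<longrightarrow>
        (\<exists>r. has_outcome H r \<and>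
             computes_within P w (c * hypergraph_size H ^ k + c) (outcome_code r))"
proof -
  \<comment> \<open>The conjunction serves to obtain one \<open>c\<close> and \<open>k\<close> for
    the sum of both running times.\<close>
  obtain c k where ck: "\<And>S. time_bound (Conj Second_To_Last_Win Last_Win) S \<le> c * Suc S ^ k"
    using time_bound_polynomial by blast
  define C where "C = c * 2 ^ k + c + 6"
  have bound: "time_bound Second_To_Last_Win S + time_bound Last_Win S + 6 \<le> C * S ^ k + C" for S
  proof -
    have "c * Suc S ^ k \<le> c * (2 ^ k * S ^ k + 1)" by (intro mult_le_mono2 Suc_power_le)
    then have "time_bound Second_To_Last_Win S + time_bound Last_Win S + 6 \<le>
        c * 2 ^ k * S ^ k + c + 6"
      using ck[of S] by (simp add: distrib_left mult.assoc)
    also have "\<dots> \<le> C * S ^ k + C" by (simp add: C_def distrib_right)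
    finally show ?thesis .
  qed
  show ?thesis
  proof (rule exI[of _ outcome_program], rule exI[of _ C], rule exI[of _ k], intro allI impI)
    fix H :: "'a hypergraph" and w
    assume H: "hypergraph H \<and> rank_le 2 H \<and> encodes w H"
    then show "\<exists>r. has_outcome H r \<and>
        computes_within outcome_program w (C * hypergraph_size H ^ k + C) (outcome_code r)"
      using has_outcome_computed[of H] outcome_program_correct[of H w] bound[of "hypergraph_size H"]
      unfolding computes_within_def by (meson order_trans)
  qed
qed

end
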